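(* Let $\lambda,\mu>0$, $\xi>0$, $\alpha\in(0,1]$, and let $\{X^\alpha_t\}_{t\ge0}$ be a fractional $M/M/1$ queue with catastrophes of parameter $\alpha$ (arrival rate $\lambda$, service rate $\mu$, catastrophe rate $\xi$) started from $X^\alpha_0=i$, with $P^\alpha_{i,n}(t)=P(X^\alpha_t=n\mid X^\alpha_0=i)$. Then for every $t>0$ the expectation of $X^\alpha_t$ is $$\mathbb{E}[X^\alpha_t]=iE^1_{\alpha,1}(-\xi t^\alpha)+\mu\,[P^\alpha_{i,0}(t)]\ast[t^{\alpha-1}E^1_{\alpha,\alpha}(-\xi t^\alpha)]+\frac{\lambda-\mu}{\xi}\left(1-E^1_{\alpha,1}(-\xi t^\alpha)\right).$$
   Context: Fractional queue. For $\alpha\in(0,1]$, $\lambda,\mu>0$, $\xi\ge0$, a fractional $M/M/1$ queue with catastrophes of parameter $\alpha$ is a continuous-time stochastic process $\{X^\alpha_t\}_{t\ge0}$ with values in $\{0,1,2,\dots\}$ whose transition probabilities $P^\alpha_{i,n}(t):=P(X^\alpha_t=n\mid X^\alpha_0=i)$ satisfy, for $t>0$ and $i\ge0$, $$D^\alpha_tP^\alpha_{i,0}(t)=-(\lambda+\xi)P^\alpha_{i,0}(t)+\mu P^\alpha_{i,1}(t)+\xi,$$ $$D^\alpha_tP^\alpha_{i,n}(t)=-(\lambda+\mu+\xi)P^\alpha_{i,n}(t)+\lambda P^\alpha_{i,n-1}(t)+\mu P^\alpha_{i,n+1}(t)\quad(n\ge1),$$ $$P^\alpha_{i,n}(0)=\delta_{i,n}\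 \text{(Kronecker delta)},$$ where for $\alpha\in(0,1)$ $D^\alpha_t f(t)=\frac{1}{\Gamma(1-\alpha)}\int_0^t\frac{f'(s)}{(t-s)^\alpha}ds$ is the Caputo derivative, and for $\alpha=1$ $D^1_t=d/dt$. Notation. $E^\delta_{\beta,\gamma}(w)=\sum_{r=0}^\infty\frac{w^r\,\Gamma(\delta+r)}{r!\,\Gamma(\beta r+\gamma)\,\Gamma(\delta)}$ is the three-parameter Mittag-Leffler function ($\Re\beta>0$). The convolution in $t$ is $f(t)\ast g(t)=\int_0^t f(u)g(t-u)\,du$. *)

theory Defs
  imports "HOL-Probability.Probability"
begin

text \<open>
  The three-parameter Mittag-Leffler function, for real and for complex arguments. At the poles of
  the Gamma function the library sets \<open>Gamma z = 0\<close>, so a summand whose \<open>Gamma (\<beta> r + \<gamma>)\<close> has a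
  pole vanishes, as it does under the usual convention \<open>1 / Gamma = 0\<close>.
\<close>

definition mittag_leffler :: "'a::Gamma \<Rightarrow> 'a \<Rightarrow> 'a \<Rightarrow> 'a \<Rightarrow> 'a" where
  "mittag_leffler \<delta> \<beta> \<gamma> w =
     (\<Sum>r. (w ^ r * Gamma (\<delta> + of_nat r)) / (fact r * Gamma (\<beta> * of_nat r + \<gamma>) * Gamma \<delta>))"

definition time_convolution :: "(real \<Rightarrow> real) \<Rightarrow> (real \<Rightarrow> real) \<Rightarrow> real \<Rightarrow> real" where
  "time_convolution f g t = (LINT u:{0..t}|lebesgue. f u * g (t - u))"

text \<open>
  Local absolute continuity on \<open>[0, \<infinity>)\<close>: \<open>f\<close> is the indefinite Lebesgue integral of its almost
  everywhere defined derivative. This is the usual domain of the Caputo derivative. Without it the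
  values \<open>f' s\<close> for \<open>s > 0\<close> would not be tied to the initial value \<open>f 0\<close>. The values of \<open>deriv f\<close> on
  the null set where \<open>f\<close> is not differentiable are irrelevant, the measure being complete.
\<close>

definition locally_absolutely_continuous :: "(real \<Rightarrow> real) \<Rightarrow> bool" where
  "locally_absolutely_continuous f \<longleftrightarrow>
     (AE s in lebesgue. 0 < s \<longrightarrow> f differentiable at s) \<and>
     (\<forall>t\<ge>0. set_integrable lebesgue {0..t} (deriv f) \<and>
            f t = f 0 + (LINT s:{0..t}|lebesgue. deriv f s))"

text \<open>
  \<open>D\<close> is the value at \<open>t > 0\<close> of the Caputo derivative of order \<open>\<alpha> \<in> (0, 1]\<close> of \<open>f\<close>. It is a
  relation in order to include the existence of the defining integral.
\<close>

definition has_caputo_derivative :: "real \<Rightarrow> (real \<Rightarrow> real) \<Rightarrow> real \<Rightarrow> real \<Rightarrow> bool" where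
  "has_caputo_derivative \<alpha> f D t \<longleftrightarrow>
     (if \<alpha> = 1 then (f has_real_derivative D) (at t)
      else set_integrable lebesgue {0..t} (\<lambda>s. deriv f s / (t - s) powr \<alpha>) \<and>
           D = 1 / Gamma (1 - \<alpha>) * (LINT s:{0..t}|lebesgue. deriv f s / (t - s) powr \<alpha>))"

definition transition_prob :: "'w measure \<Rightarrow> (real \<Rightarrow> 'w \<Rightarrow> nat) \<Rightarrow> nat \<Rightarrow> nat \<Rightarrow> real \<Rightarrow> real" where
  "transition_prob M X i n t = \<P>(\<omega> in M. X t \<omega> = n \<bar> X 0 \<omega> = i)"

text \<open>
  Only the random variables \<open>X t\<close> with \<open>t \<ge> 0\<close> matter. The conditional probabilities given
  \<open>X 0 = i\<close>, and hence the equations for the initial state \<open>i\<close>, make sense only for those \<open>i\<close> that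
  are attained by \<open>X 0\<close> with positive probability.
\<close>

locale fractional_queue_catastrophes = prob_space M
  for M :: "'w measure" +
  fixes X :: "real \<Rightarrow> 'w \<Rightarrow> nat" and \<alpha> lam \<mu> \<xi> :: real
  assumes order: "0 < \<alpha>" "\<alpha> \<le> 1"
    and rates: "0 < lam" "0 < \<mu>" "0 \<le> \<xi>"
    and process: "\<And>t. 0 \<le> t \<Longrightarrow> X t \<in> M \<rightarrow>\<^sub>M count_space UNIV"
    and abs_continuous: "\<And>i n. 0 < \<P>(\<omega> in M. X 0 \<omega> = i) \<Longrightarrow>
      locally_absolutely_continuous (transition_prob M X i n)"
    and equation_zero: "\<And>i t. 0 < \<P>(\<omega> in M. X 0 \<omega> = i) \<Longrightarrow> 0 < t \<Longrightarrow>
      has_caputo_derivative \<alpha> (transition_prob M X i 0)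
        (- (lam + \<xi>) * transition_prob M X i 0 t + \<mu> * transition_prob M X i 1 t + \<xi>) t"
    and equation_pos: "\<And>i n t. 0 < \<P>(\<omega> in M. X 0 \<omega> = i) \<Longrightarrow> 1 \<le> n \<Longrightarrow> 0 < t \<Longrightarrow>
      has_caputo_derivative \<alpha> (transition_prob M X i n)
        (- (lam + \<mu> + \<xi>) * transition_prob M X i n t + lam * transition_prob M X i (n - 1) t
          + \<mu> * transition_prob M X i (n + 1) t) t"
    and initial: "\<And>i n. 0 < \<P>(\<omega> in M. X 0 \<omega> = i) \<Longrightarrow>
      transition_prob M X i n 0 = (if i = n then 1 else 0)"

end

theory Submission
  imports Defs
begin

text \<open>
  Write \<open>k a x = x powr (a - 1) / Gamma a\<close> for \<open>x > 0\<close> and let \<open>I a f\<close> be the Riemann--Liouville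
  integral of \<open>f\<close> of order \<open>a\<close>, the convolution of \<open>k a\<close> with \<open>f\<close>. The Beta integral
  gives \<open>k a * k b = k (a + b)\<close>, hence the semigroup law \<open>I a (I b f) = I (a + b) f\<close>
  (\<open>frac_int_frac_int\<close>). As the Caputo derivative of order \<open>\<alpha> < 1\<close> is \<open>I (1 - \<alpha>)\<close> applied to the
  derivative, and the ordinary derivative if \<open>\<alpha> = 1\<close>, applying \<open>I \<alpha>\<close> to the equations of the
  queue turns them into the Volterra equations
  \<open>p n = [i = n] + I \<alpha> (r n)\<close>, where \<open>p n\<close> is the transition probability from \<open>i\<close> to \<open>n\<close> and
  \<open>r n\<close> the right-hand side of the equation for \<open>n\<close> (\<open>caputo_imp_volterra\<close>).

  All estimates rest on one fact: if \<open>\<bar>f t\<bar> \<le> C * exp (s * t)\<close> for \<open>t \<ge> 0\<close>, then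
  \<open>\<bar>I a f t\<bar> \<le> C * s powr (- a) * exp (s * t)\<close>, because the Laplace transform of \<open>k a\<close> at \<open>s\<close> is
  \<open>s powr (- a)\<close> (\<open>frac_int_bound\<close>). Thus for large \<open>s\<close> the operator \<open>I \<alpha>\<close> is a strong contraction
  in the corresponding weighted supremum norm.

  For \<open>n > i\<close> the Volterra equation and \<open>p n \<ge> 0\<close> give
  \<open>p n \<le> I \<alpha> (lam * p (n - 1) + \<mu> * p (n + 1))\<close>. Starting from \<open>p n \<le> 1\<close>, every application of this
  inequality with a large \<open>s\<close> gains a factor \<open>1/2\<close>, at the price of moving one step away from \<open>i\<close>.
  Hence \<open>p n t\<close> decays geometrically in \<open>n\<close>, uniformly in the weighted norm
  (\<open>tail_decay\<close>, \<open>p_decay\<close>). So the mean \<open>m t = (\<Sum>n. n * p n t)\<close> is finite for every \<open>t\<close>, and the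
  Volterra equations may be multiplied by \<open>n\<close> and summed; as the \<open>p n t\<close> sum to \<open>1\<close>,
  \<open>m = i + I \<alpha> (lam - \<mu> + \<mu> * p 0 - \<xi> * m)\<close> (\<open>mean_volterra\<close>).

  Substituting this equation into itself produces the series of the terms
  \<open>(- \<xi>) ^ k * (i * I (k * \<alpha>) 1 + I ((k + 1) * \<alpha>) (lam - \<mu> + \<mu> * p 0))\<close>, with a remainder
  that tends to zero by the contraction estimate. The kernels of this series add up to the
  Mittag-Leffler functions of the claim (\<open>volterra_mittag_leffler\<close>).
\<close>

section \<open>Lebesgue measure and the kernels of fractional integration\<close>

lemma sigma_finite_measure_lebesgue: "sigma_finite_measure lebesgue"
proof -
  obtain A :: "'a set set" where A: "countable A" "A \<subseteq> sets lborel" "\<Union>A = space lborel"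
      "\<forall>a\<in>A. emeasure lborel a \<noteq> \<infinity>"
    using lborel.sigma_finite_countable by blast
  show ?thesis
  proof
    show "\<exists>A::'a set set. countable A \<and> A \<subseteq> sets lebesgue \<and> \<Union>A = space lebesgue \<and>
        (\<forall>a\<in>A. emeasure lebesgue a \<noteq> \<infinity>)"
    proof (intro exI[of _ A] conjI)
      show "\<forall>a\<in>A. emeasure lebesgue a \<noteq> \<infinity>"
        using A(2,4) by auto
    qed (use A in auto)
  qed
qed

interpretation lebesgue: sigma_finite_measure "lebesgue :: real measure"
  by (rule sigma_finite_measure_lebesgue)

interpretation lebesgue_pair: pair_sigma_finite "lebesgue :: real measure" "lebesgue :: real measure" ..

lemma measurable_ident_lebesgue [measurable]: "(\<lambda>x. x) \<in> borel_measurable lebesgue"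
  using id_borel_measurable_lebesgue by (simp add: id_def)

text \<open>
  The kernel of the Riemann--Liouville integral of order \<open>a\<close>. It is extended by zero to the
  nonpositive arguments, so that convolutions of such kernels are integrals over the whole line.
\<close>

definition frac_kernel :: "real \<Rightarrow> real \<Rightarrow> real" where
  "frac_kernel a x = (if 0 < x then x powr (a - 1) / Gamma a else 0)"

lemma frac_kernel_measurable [measurable]: "frac_kernel a \<in> borel_measurable borel"
  unfolding frac_kernel_def by measurable

lemma frac_kernel_nonneg: "0 < a \<Longrightarrow> 0 \<le> frac_kernel a x"
  by (auto simp: frac_kernel_def intro!: divide_nonneg_pos Gamma_real_pos)

lemma nn_integral_frac_kernel_exp:
  assumes a: "0 < a" and s: "0 < s"
  shows "(\<integral>\<^sup>+x. ennreal (frac_kernel a x * exp (- s * x)) \<partial>lborel) = ennreal (s powr - a)"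
proof -
  have G: "0 < Gamma a" using a by (rule Gamma_real_pos)
  have "ennreal (Gamma a) = (\<integral>\<^sup>+x. ennreal (indicator {0..} x * x powr (a - 1) / exp x) \<partial>lborel)"
    by (rule Gamma_conv_nn_integral_real[OF a])
  also have "\<dots> = ennreal s * (\<integral>\<^sup>+x. ennreal (indicator {0..} (s * x) * (s * x) powr (a - 1) / exp (s * x)) \<partial>lborel)"
    using s by (subst nn_integral_real_affine[where c = s and t = 0]) auto
  also have "\<dots> = ennreal s * (\<integral>\<^sup>+x. ennreal (s powr (a - 1) * Gamma a) * ennreal (frac_kernel a x * exp (- s * x)) \<partial>lborel)"
  proof (intro arg_cong2[where f = "(*)"] refl nn_integral_cong)
    fix x :: real
    show "ennreal (indicator {0..} (s * x) * (s * x) powr (a - 1) / exp (s * x)) =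
          ennreal (s powr (a - 1) * Gamma a) * ennreal (frac_kernel a x * exp (- s * x))"
    proof (cases "0 < x")
      case True
      then show ?thesis using s G
        by (subst ennreal_mult'[symmetric])
           (auto simp: frac_kernel_def powr_mult exp_minus field_simps)
    next
      case False
      then show ?thesis using s G
        by (cases "x = 0") (auto simp: frac_kernel_def indicator_def zero_le_mult_iff)
    qed
  qed
  also have "\<dots> = ennreal (s powr a * Gamma a) * (\<integral>\<^sup>+x. ennreal (frac_kernel a x * exp (- s * x)) \<partial>lborel)"
    using s G by (subst nn_integral_cmult)
      (auto simp: mult.assoc[symmetric] ennreal_mult'[symmetric] powr_diff)
  finally have "ennreal (s powr - a * inverse (Gamma a)) * ennreal (Gamma a) =
      ennreal (s powr - a * inverse (Gamma a)) * (ennreal (s powr a * Gamma a) * (\<integral>\<^sup>+x. ennreal (frac_kernel a x * exp (- s * x)) \<partial>lborel))"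
    by simp
  moreover have "ennreal (s powr - a * inverse (Gamma a)) * ennreal (Gamma a) = ennreal (s powr - a)"
    using G by (subst ennreal_mult'[symmetric]) auto
  moreover have "ennreal (s powr - a * inverse (Gamma a)) * ennreal (s powr a * Gamma a) = 1"
    using s G by (subst ennreal_mult'[symmetric]) (auto simp: powr_minus field_simps)
  ultimately show ?thesis by (simp add: mult.assoc[symmetric])
qed

lemma nn_integral_frac_kernel_convolution:
  assumes a: "0 < a" and b: "0 < b"
  shows "(\<integral>\<^sup>+s. ennreal (frac_kernel a (t - s) * frac_kernel b (s - u)) \<partial>lborel)
    = ennreal (frac_kernel (a + b) (t - u))"
proof (cases "u < t")
  case False
  then have "(\<integral>\<^sup>+s. ennreal (frac_kernel a (t - s) * frac_kernel b (s - u)) \<partial>lborel)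
      = (\<integral>\<^sup>+s. 0 \<partial>(lborel :: real measure))"
    by (intro nn_integral_cong) (auto simp: frac_kernel_def)
  then show ?thesis using False by (simp add: frac_kernel_def)
next
  case True
  define d where "d = t - u"
  have d: "0 < d" using True by (simp add: d_def)
  have G: "0 < Gamma a" "0 < Gamma b" "0 < Gamma (a + b)" using a b by (auto intro: Gamma_real_pos)
  have B: "(\<integral>\<^sup>+x. ennreal (indicator {0..1} x * (x powr (b - 1) * (1 - x) powr (a - 1))) \<partial>lborel) = ennreal (Beta b a)"
    by (rule nn_integral_has_integral_lebesgue[OF _ has_integral_Beta_real[OF b a]]) auto
  have "(\<integral>\<^sup>+s. ennreal (frac_kernel a (t - s) * frac_kernel b (s - u)) \<partial>lborel)
    = ennreal d * (\<integral>\<^sup>+x. ennreal (frac_kernel a (t - (u + d * x)) * frac_kernel b (u + d * x - u)) \<partial>lborel)"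
    using d by (subst nn_integral_real_affine[where c = d and t = u]) auto
  also have "\<dots> = ennreal d * (\<integral>\<^sup>+x. ennreal (d powr (a + b - 2) / (Gamma a * Gamma b)) *
      ennreal (indicator {0..1} x * (x powr (b - 1) * (1 - x) powr (a - 1))) \<partial>lborel)"
  proof (intro arg_cong2[where f = "(*)"] refl nn_integral_cong)
    fix x :: real
    have 1: "t - (u + d * x) = d * (1 - x)" by (simp add: d_def algebra_simps)
    show "ennreal (frac_kernel a (t - (u + d * x)) * frac_kernel b (u + d * x - u)) =
      ennreal (d powr (a + b - 2) / (Gamma a * Gamma b)) *
      ennreal (indicator {0..1} x * (x powr (b - 1) * (1 - x) powr (a - 1)))"
    proof (cases "0 < x \<and> x < 1")
      case True
      have "d powr (a - 1) * d powr (b - 1) = d powr (a + b - 2)"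
        by (simp add: powr_add[symmetric])
      then show ?thesis unfolding 1 using d G True
        by (subst ennreal_mult'[symmetric])
           (auto simp: frac_kernel_def powr_mult zero_less_mult_iff)
    next
      case False
      then have "x \<le> 0 \<or> 1 \<le> x" by auto
      then show ?thesis unfolding 1 using d G
        by (auto simp: frac_kernel_def zero_less_mult_iff indicator_def)
    qed
  qed
  also have "\<dots> = ennreal (d * (d powr (a + b - 2) / (Gamma a * Gamma b)) * Beta b a)"
    using d G by (subst nn_integral_cmult) (auto simp: B ennreal_mult'[symmetric] mult.assoc)
  also have "d * d powr (a + b - 2) = d powr (a + b - 1)"
    using d by (subst powr_mult_base) (auto simp: add_diff_eq)
  then have "d * (d powr (a + b - 2) / (Gamma a * Gamma b)) * Beta b a = frac_kernel (a + b) (t - u)"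
    using d G by (simp add: Beta_def frac_kernel_def d_def add.commute)
  finally show ?thesis .
qed

section \<open>The Riemann--Liouville integral\<close>

text \<open>
  The Riemann--Liouville integral of order \<open>a\<close> of a function on \<open>[0, \<infinity>)\<close>. The kernel vanishes for
  \<open>u \<ge> t\<close>, so this is the usual integral over \<open>[0, t]\<close>; a domain that does not depend on \<open>t\<close>
  is convenient when the order of integration is exchanged.
\<close>

definition frac_int :: "real \<Rightarrow> (real \<Rightarrow> real) \<Rightarrow> real \<Rightarrow> real" where
  "frac_int a f t = (LINT u:{0..}|lebesgue. frac_kernel a (t - u) * f u)"

lemma set_borel_measurable_lincomb:
  assumes "set_borel_measurable lebesgue {0..} f" "set_borel_measurable lebesgue {0..} g"
  shows "set_borel_measurable lebesgue {0..} (\<lambda>u. (a::real) * f u + b * g u :: real)"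
proof -
  have "(\<lambda>u. a * (indicator {0..} u *\<^sub>R f u) + b * (indicator {0..} u *\<^sub>R g u)) \<in> borel_measurable lebesgue"
    using assms unfolding set_borel_measurable_def by (intro borel_measurable_add borel_measurable_times) auto
  then show ?thesis unfolding set_borel_measurable_def by (simp add: algebra_simps)
qed

text \<open>
  Measurable functions on \<open>[0, \<infinity>)\<close> of exponential growth: \<open>C\<close> bounds the supremum norm with
  the weight \<open>exp (- s * u)\<close>. The values at negative arguments are irrelevant.
\<close>

definition exp_bounded :: "real \<Rightarrow> real \<Rightarrow> (real \<Rightarrow> real) \<Rightarrow> bool" where
  "exp_bounded s C f \<longleftrightarrow>
     set_borel_measurable lebesgue {0..} f \<and> (\<forall>u\<ge>0. \<bar>f u\<bar> \<le> C * exp (s * u))"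

lemma exp_boundedI:
  "set_borel_measurable lebesgue {0..} f \<Longrightarrow> (\<And>u. 0 \<le> u \<Longrightarrow> \<bar>f u\<bar> \<le> C * exp (s * u)) \<Longrightarrow> exp_bounded s C f"
  by (auto simp: exp_bounded_def)

lemma exp_bounded_le: "exp_bounded s C f \<Longrightarrow> 0 \<le> u \<Longrightarrow> \<bar>f u\<bar> \<le> C * exp (s * u)"
  by (auto simp: exp_bounded_def)

lemma exp_bounded_add:
  assumes "exp_bounded s C f" "exp_bounded s D g"
  shows "exp_bounded s (C + D) (\<lambda>u. f u + g u)"
proof (rule exp_boundedI)
  show "set_borel_measurable lebesgue {0..} (\<lambda>u. f u + g u)"
    using assms borel_measurable_add[of "\<lambda>x. indicator {0..} x *\<^sub>R f x" lebesgue "\<lambda>x. indicator {0..} x *\<^sub>R g x"]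
    by (simp add: exp_bounded_def set_borel_measurable_def algebra_simps)
next
  fix u :: real assume "0 \<le> u"
  then have "\<bar>f u\<bar> + \<bar>g u\<bar> \<le> C * exp (s * u) + D * exp (s * u)"
    using assms by (intro add_mono exp_bounded_le)
  then show "\<bar>f u + g u\<bar> \<le> (C + D) * exp (s * u)"
    using abs_triangle_ineq[of "f u" "g u"] by (simp add: algebra_simps)
qed

lemma exp_bounded_cmult:
  assumes "exp_bounded s C f"
  shows "exp_bounded s (\<bar>c\<bar> * C) (\<lambda>u. c * f u)"
proof (rule exp_boundedI)
  show "set_borel_measurable lebesgue {0..} (\<lambda>u. c * f u)"
    using assms borel_measurable_times[of "\<lambda>x. c" lebesgue "\<lambda>x. indicator {0..} x *\<^sub>R f x"]
    by (simp add: exp_bounded_def set_borel_measurable_def algebra_simps)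
next
  fix u :: real assume "0 \<le> u"
  then show "\<bar>c * f u\<bar> \<le> (\<bar>c\<bar> * C) * exp (s * u)"
    using exp_bounded_le[OF assms] by (simp add: abs_mult mult.assoc mult_left_mono)
qed

lemma exp_bounded_const:
  assumes "0 \<le> s"
  shows "exp_bounded s \<bar>c\<bar> (\<lambda>u. c)"
proof (rule exp_boundedI)
  fix u :: real assume "0 \<le> u"
  then show "\<bar>c\<bar> \<le> \<bar>c\<bar> * exp (s * u)"
    using assms mult_left_mono[of 1 "exp (s * u)" "\<bar>c\<bar>"] by simp
qed (simp add: set_borel_measurable_def)

lemma has_bochner_integral_frac_kernel_exp:
  assumes a: "0 < a" and s: "0 < s"
  shows "has_bochner_integral lebesgue (\<lambda>u. frac_kernel a (t - u) * exp (s * u)) (s powr - a * exp (s * t))"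
proof (rule has_bochner_integral_nn_integral)
  have [measurable]: "(\<lambda>u. t - u) \<in> borel_measurable lebesgue" by measurable
  show "(\<lambda>u. frac_kernel a (t - u) * exp (s * u)) \<in> borel_measurable lebesgue"
    by measurable
  show "AE u in lebesgue. 0 \<le> frac_kernel a (t - u) * exp (s * u)"
    using frac_kernel_nonneg[OF a] by auto
  show "0 \<le> s powr - a * exp (s * t)" by simp
  have "(\<integral>\<^sup>+u. ennreal (frac_kernel a (t - u) * exp (s * u)) \<partial>lborel)
      = (\<integral>\<^sup>+u. ennreal (frac_kernel a (t - (t + (-1) * u)) * exp (s * (t + (-1) * u))) \<partial>lborel)"
    by (subst nn_integral_real_affine[where c = "-1" and t = t]) auto
  also have "\<dots> = (\<integral>\<^sup>+u. ennreal (exp (s * t)) * ennreal (frac_kernel a u * exp (- s * u)) \<partial>lborel)"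
    using a by (intro nn_integral_cong)
      (simp add: ennreal_mult'[symmetric] frac_kernel_nonneg right_diff_distrib exp_diff exp_minus field_simps)
  also have "\<dots> = ennreal (s powr - a * exp (s * t))"
    by (subst nn_integral_cmult) (simp_all only: nn_integral_frac_kernel_exp[OF a s], auto simp: ennreal_mult mult.commute)
  finally show "(\<integral>\<^sup>+u. ennreal (frac_kernel a (t - u) * exp (s * u)) \<partial>lebesgue) = ennreal (s powr - a * exp (s * t))"
    by (simp add: nn_integral_completion)
qed

lemma frac_kernel_measurable_lebesgue [measurable]:
  "(\<lambda>u. frac_kernel a (t - u)) \<in> borel_measurable lebesgue"
proof -
  have [measurable]: "(\<lambda>u. t - u) \<in> borel_measurable lebesgue" by measurable
  show ?thesis by measurable
qed

lemma exp_bounded_measurable: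
  "exp_bounded s C f \<Longrightarrow> (\<lambda>u. indicator {0..} u * f u) \<in> borel_measurable lebesgue"
  by (simp add: exp_bounded_def set_borel_measurable_def)

text \<open>
  In the supremum norm with weight \<open>exp (- s * u)\<close>, fractional integration of order \<open>a\<close> has norm at
  most \<open>s powr - a\<close>, which is small for large \<open>s\<close>.
\<close>

lemma
  assumes a: "0 < a" and s: "0 < s" and f: "exp_bounded s C f"
  shows set_integrable_frac_int: "set_integrable lebesgue {0..} (\<lambda>u. frac_kernel a (t - u) * f u)" (is ?I)
    and frac_int_norm_bound:
      "(LINT u|lebesgue. norm (indicator {0..} u *\<^sub>R (frac_kernel a (t - u) * f u))) \<le> C * (s powr - a * exp (s * t))"
    and frac_int_bound: "\<bar>frac_int a f t\<bar> \<le> C * (s powr - a * exp (s * t))"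
proof -
  let ?g = "\<lambda>u. indicator {0..} u *\<^sub>R (frac_kernel a (t - u) * f u)"
  let ?h = "\<lambda>u. C * (frac_kernel a (t - u) * exp (s * u))"
  have h: "has_bochner_integral lebesgue ?h (C * (s powr - a * exp (s * t)))"
    by (intro has_bochner_integral_mult_right has_bochner_integral_frac_kernel_exp a s)
  have C: "0 \<le> C" using exp_bounded_le[OF f, of 0] by simp
  have le: "norm (?g u) \<le> ?h u" for u
    using exp_bounded_le[OF f, of u] frac_kernel_nonneg[OF a, of "t - u"] C
    by (auto simp: indicator_def abs_mult mult.left_commute[of C] intro!: mult_left_mono)
  note fm [measurable] = exp_bounded_measurable[OF f]
  have m: "?g \<in> borel_measurable lebesgue"
  proof -
    have "?g = (\<lambda>u. frac_kernel a (t - u) * (indicator {0..} u * f u))" by auto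
    then show ?thesis by simp
  qed
  have i: "integrable lebesgue ?g"
  proof (rule Bochner_Integration.integrable_bound[OF _ m])
    show "integrable lebesgue ?h" using h by (simp add: has_bochner_integral_iff)
    show "AE u in lebesgue. norm (?g u) \<le> norm (?h u)"
      using le abs_ge_self order_trans unfolding real_norm_def by blast
  qed
  then show ?I by (simp add: set_integrable_def)
  have "(LINT u|lebesgue. norm (?g u)) \<le> (LINT u|lebesgue. ?h u)"
    by (intro integral_mono integrable_norm i le) (use h in \<open>auto simp: has_bochner_integral_iff\<close>)
  also have "\<dots> = C * (s powr - a * exp (s * t))"
    by (rule has_bochner_integral_integral_eq[OF h])
  finally show *: "(LINT u|lebesgue. norm (?g u)) \<le> C * (s powr - a * exp (s * t))" .
  show "\<bar>frac_int a f t\<bar> \<le> C * (s powr - a * exp (s * t))"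
    using order_trans[OF integral_norm_bound *] by (simp add: frac_int_def set_lebesgue_integral_def)
qed

lemma kernel_product_measurable [measurable]:
  "(\<lambda>p. frac_kernel a (fst p - snd p)) \<in> borel_measurable (lebesgue \<Otimes>\<^sub>M lebesgue)"
proof -
  have [measurable]: "fst \<in> borel_measurable (lebesgue \<Otimes>\<^sub>M (lebesgue::real measure) :: (real \<times> real) measure)"
    using measurable_compose[OF measurable_fst measurable_ident_lebesgue] by simp
  have [measurable]: "snd \<in> borel_measurable ((lebesgue::real measure) \<Otimes>\<^sub>M lebesgue :: (real \<times> real) measure)"
    using measurable_compose[OF measurable_snd measurable_ident_lebesgue] by simp
  show ?thesis by measurable
qed

lemma frac_int_measurable:
  assumes f: "set_borel_measurable lebesgue {0..} f"
  shows "frac_int a f \<in> borel_measurable lebesgue"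
proof -
  have fm: "(\<lambda>u. indicator {0..} u * f u) \<in> borel_measurable lebesgue"
    using f by (simp add: set_borel_measurable_def)
  have "(\<lambda>t. LINT u|lebesgue. frac_kernel a (t - u) * (indicator {0..} u * f u)) \<in> borel_measurable lebesgue"
  proof (rule lebesgue.borel_measurable_lebesgue_integral)
    have "(\<lambda>p. frac_kernel a (fst p - snd p) * (indicator {0..} (snd p) * f (snd p)))
        \<in> borel_measurable (lebesgue \<Otimes>\<^sub>M lebesgue)"
      by (rule borel_measurable_times[OF kernel_product_measurable measurable_compose[OF measurable_snd fm]])
    then show "(\<lambda>(t, u). frac_kernel a (t - u) * (indicator {0..} u * f u)) \<in> borel_measurable (lebesgue \<Otimes>\<^sub>M lebesgue)"
      by (simp add: split_beta')
  qed
  also have "(\<lambda>t. LINT u|lebesgue. frac_kernel a (t - u) * (indicator {0..} u * f u)) = frac_int a f"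
    by (simp add: fun_eq_iff frac_int_def set_lebesgue_integral_def mult.left_commute)
  finally show ?thesis .
qed

lemma exp_bounded_frac_int:
  assumes a: "0 < a" and s: "0 < s" and f: "exp_bounded s C f"
  shows "exp_bounded s (C * s powr - a) (frac_int a f)"
proof (rule exp_boundedI)
  have "frac_int a f \<in> borel_measurable lebesgue"
    using f by (intro frac_int_measurable) (simp add: exp_bounded_def)
  then show "set_borel_measurable lebesgue {0..} (frac_int a f)"
    by (simp add: set_borel_measurable_def)
next
  fix u :: real
  show "\<bar>frac_int a f u\<bar> \<le> C * s powr - a * exp (s * u)"
    using frac_int_bound[OF a s f, of u] by (simp add: mult.assoc)
qed

lemma frac_int_add:
  assumes "0 < a" "0 < s" "exp_bounded s C f" "exp_bounded s D g"
  shows "frac_int a (\<lambda>u. f u + g u) t = frac_int a f t + frac_int a g t"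
  using set_integral_add(2)[OF set_integrable_frac_int[OF assms(1-3)] set_integrable_frac_int[OF assms(1,2,4)]]
  by (simp add: frac_int_def distrib_left)

lemma frac_int_cmult: "frac_int a (\<lambda>u. c * f u) t = c * frac_int a f t"
  by (simp add: frac_int_def mult.left_commute)

lemma frac_int_cong: "(\<And>u. 0 \<le> u \<Longrightarrow> u < t \<Longrightarrow> f u = g u) \<Longrightarrow> frac_int a f t = frac_int a g t"
  unfolding frac_int_def by (intro set_lebesgue_integral_cong) (auto simp: frac_kernel_def)

lemma frac_int_mono:
  assumes "0 < a" "0 < s" "exp_bounded s C f" "exp_bounded s D g"
    and "\<And>u. 0 \<le> u \<Longrightarrow> f u \<le> g u"
  shows "frac_int a f t \<le> frac_int a g t"
  unfolding frac_int_def
  using assms by (intro set_integral_mono set_integrable_frac_int[of a s C f] set_integrable_frac_int[of a s D g])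
    (auto intro!: mult_left_mono frac_kernel_nonneg)

lemma frac_int_sums:
  assumes a: "0 < a" and s: "0 < s" and f: "\<And>n. exp_bounded s (c n) (f n)" and c: "summable c"
  shows "(\<lambda>n. frac_int a (f n) t) sums frac_int a (\<lambda>u. \<Sum>n. f n u) t"
proof -
  let ?g = "\<lambda>n u. indicator {0..} u *\<^sub>R (frac_kernel a (t - u) * f n u)"
  have sf: "summable (\<lambda>n. norm (f n u))" if "0 \<le> u" for u
  proof (rule summable_comparison_test')
    show "summable (\<lambda>n. c n * exp (s * u))" by (rule summable_mult2[OF c])
    show "norm (norm (f n u)) \<le> c n * exp (s * u)" for n
      using exp_bounded_le[OF f that] by simp
  qed
  have "(\<lambda>n. integral\<^sup>L lebesgue (?g n)) sums (LINT u|lebesgue. (\<Sum>n. ?g n u))"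
  proof (rule sums_integral)
    show "integrable lebesgue (?g n)" for n
      using set_integrable_frac_int[OF a s f] by (simp add: set_integrable_def)
    show "AE u in lebesgue. summable (\<lambda>n. norm (?g n u))"
    proof (intro always_eventually allI)
      fix u :: real
      show "summable (\<lambda>n. norm (?g n u))"
        using summable_mult[OF sf, of u "\<bar>frac_kernel a (t - u)\<bar>"]
        by (cases "0 \<le> u") (simp_all add: abs_mult)
    qed
    show "summable (\<lambda>n. LINT u|lebesgue. norm (?g n u))"
    proof (rule summable_comparison_test')
      show "summable (\<lambda>n. c n * (s powr - a * exp (s * t)))" by (rule summable_mult2[OF c])
      show "norm (LINT u|lebesgue. norm (?g n u)) \<le> c n * (s powr - a * exp (s * t))" for n
        using frac_int_norm_bound[OF a s f, of t n] by (simp add: integral_nonneg_AE)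
    qed
  qed
  also have "(LINT u|lebesgue. (\<Sum>n. ?g n u)) = frac_int a (\<lambda>u. \<Sum>n. f n u) t"
    unfolding frac_int_def set_lebesgue_integral_def
  proof (intro Bochner_Integration.integral_cong refl)
    fix u :: real
    show "(\<Sum>n. ?g n u) = indicator {0..} u *\<^sub>R (frac_kernel a (t - u) * (\<Sum>n. f n u))"
      using suminf_mult[OF summable_norm_cancel[OF sf], of u "frac_kernel a (t - u)"]
      by (cases "0 \<le> u") simp_all
  qed
  finally show ?thesis by (simp add: frac_int_def set_lebesgue_integral_def)
qed

lemma has_bochner_integral_kernel_convolution:
  assumes "0 < a" "0 < b"
  shows "has_bochner_integral lebesgue (\<lambda>s. frac_kernel a (t - s) * frac_kernel b (s - u)) (frac_kernel (a + b) (t - u))"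
proof (rule has_bochner_integral_nn_integral)
  have [measurable]: "(\<lambda>s. s - u) \<in> borel_measurable lebesgue" by measurable
  show "(\<lambda>s. frac_kernel a (t - s) * frac_kernel b (s - u)) \<in> borel_measurable lebesgue" by measurable
qed (use assms in \<open>auto simp: frac_kernel_nonneg nn_integral_completion nn_integral_frac_kernel_convolution\<close>)

lemma frac_int_const:
  assumes "0 < a"
  shows "frac_int a (\<lambda>u. c) t = c * frac_kernel (a + 1) t"
proof -
  have *: "AE u in lebesgue. u \<noteq> (0::real)"
    by (intro AE_completion AE_lborel_singleton)
  have "frac_int a (\<lambda>u. 1) t = (LINT s|lebesgue. frac_kernel a (t - s) * frac_kernel 1 (s - 0))"
    unfolding frac_int_def set_lebesgue_integral_def
  proof (rule integral_cong_AE)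
    show "(\<lambda>s. frac_kernel a (t - s) * frac_kernel 1 (s - 0)) \<in> borel_measurable lebesgue"
      using has_bochner_integral_kernel_convolution[OF assms, of 1 t 0]
      by (simp add: has_bochner_integral_iff borel_measurable_integrable)
    show "(\<lambda>u. indicator {0..} u *\<^sub>R (frac_kernel a (t - u) * 1)) \<in> borel_measurable lebesgue"
      by (intro borel_measurable_scaleR borel_measurable_indicator borel_measurable_times) auto
    show "AE u in lebesgue. indicator {0..} u *\<^sub>R (frac_kernel a (t - u) * 1) = frac_kernel a (t - u) * frac_kernel 1 (u - 0)"
      using * by (auto elim!: eventually_mono simp: frac_kernel_def indicator_def)
  qed
  also have "\<dots> = frac_kernel (a + 1) t"
    using has_bochner_integral_integral_eq[OF has_bochner_integral_kernel_convolution[OF assms, of 1 t 0]] by simp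
  finally show ?thesis using frac_int_cmult[of a c "\<lambda>u. 1" t] by simp
qed

text \<open>
  The semigroup law. It is enough that the integral of order \<open>a + b\<close> converges absolutely at \<open>t\<close>;
  for \<open>a + b = 1\<close> this covers every integrable \<open>f\<close>, in particular the derivative of an absolutely
  continuous function.
\<close>

lemma frac_int_frac_int:
  assumes a: "0 < a" and b: "0 < b"
    and fm: "set_borel_measurable lebesgue {0..} f"
    and fi: "set_integrable lebesgue {0..} (\<lambda>u. frac_kernel (a + b) (t - u) * f u)"
  shows "frac_int a (frac_int b f) t = frac_int (a + b) f t"
proof -
  define g where "g = (\<lambda>u. indicator {0..} u * f u)"
  have gm: "g \<in> borel_measurable lebesgue" using fm by (simp add: set_borel_measurable_def g_def)
  define F where "F = (\<lambda>s u. frac_kernel a (t - s) * frac_kernel b (s - u) * g u)"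
  \<comment> \<open>Integrating the nonnegative kernels in the intermediate variable first gives the kernel of
    order \<open>a + b\<close>, so Fubini's theorem applies.\<close>
  have int: "integrable (lebesgue \<Otimes>\<^sub>M lebesgue) (case_prod F)"
  proof -
    have "integrable (lebesgue \<Otimes>\<^sub>M lebesgue) (\<lambda>(u, s). F s u)"
    proof (rule lebesgue_pair.Fubini_integrable)
      have [measurable]: "(\<lambda>p. frac_kernel b (snd p - fst p)) \<in> borel_measurable ((lebesgue::real measure) \<Otimes>\<^sub>M (lebesgue::real measure))"
        using measurable_compose[OF measurable_pair_swap' kernel_product_measurable[of b]] by (simp add: split_beta' del: measurable_pair_swap')
      have [measurable]: "(\<lambda>p. frac_kernel a (t - snd p)) \<in> borel_measurable ((lebesgue::real measure) \<Otimes>\<^sub>M (lebesgue::real measure))"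
        by (rule measurable_compose[OF measurable_snd frac_kernel_measurable_lebesgue])
      have [measurable]: "(\<lambda>p. g (fst p)) \<in> borel_measurable ((lebesgue::real measure) \<Otimes>\<^sub>M (lebesgue::real measure))"
        by (rule measurable_compose[OF measurable_fst gm])
      show "(\<lambda>(u, s). F s u) \<in> borel_measurable (lebesgue \<Otimes>\<^sub>M lebesgue)"
        unfolding F_def split_beta' by measurable
      have "(LINT s|lebesgue. norm (F s u)) = norm (frac_kernel (a + b) (t - u) * g u)" for u
      proof -
        have "(\<lambda>s. norm (F s u)) = (\<lambda>s. frac_kernel a (t - s) * frac_kernel b (s - u) * \<bar>g u\<bar>)"
          using a b by (simp add: F_def abs_mult frac_kernel_nonneg)
        then show ?thesis
          using has_bochner_integral_integral_eq[OF has_bochner_integral_kernel_convolution[OF a b, of t u]] a b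
          by (simp add: abs_mult frac_kernel_nonneg)
      qed
      moreover have "integrable lebesgue (\<lambda>u. frac_kernel (a + b) (t - u) * g u)"
        using fi by (simp add: set_integrable_def g_def mult.left_commute)
      ultimately show "integrable lebesgue (\<lambda>u. LINT s|lebesgue. norm (case (u, s) of (u, s) \<Rightarrow> F s u))"
        by (simp add: integrable_norm del: real_norm_def)
      show "AE u in lebesgue. integrable lebesgue (\<lambda>s. case (u, s) of (u, s) \<Rightarrow> F s u)"
        using has_bochner_integral_kernel_convolution[OF a b, of t]
        by (auto simp: F_def has_bochner_integral_iff)
    qed
    then show ?thesis
      using lebesgue_pair.integrable_product_swap_iff[of "case_prod F"] by (simp add: split_beta')
  qed
  have "frac_int (a + b) f t = (LINT u|lebesgue. LINT s|lebesgue. F s u)"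
    unfolding frac_int_def set_lebesgue_integral_def F_def
    using has_bochner_integral_integral_eq[OF has_bochner_integral_kernel_convolution[OF a b, of t]]
    by (simp add: g_def mult.left_commute)
  also have "\<dots> = (LINT s|lebesgue. LINT u|lebesgue. F s u)"
    by (rule lebesgue_pair.Fubini_integral[OF int])
  also have "\<dots> = (LINT s|lebesgue. indicator {0..} s *\<^sub>R (frac_kernel a (t - s) * frac_int b f s))"
  proof (rule Bochner_Integration.integral_cong[OF refl])
    fix s :: real
    have "(LINT u|lebesgue. F s u) = frac_kernel a (t - s) * (LINT u|lebesgue. frac_kernel b (s - u) * g u)"
      by (simp add: F_def mult.assoc)
    also have "(LINT u|lebesgue. frac_kernel b (s - u) * g u) = frac_int b f s"
      by (simp add: frac_int_def set_lebesgue_integral_def g_def mult.left_commute)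
    also have "frac_kernel a (t - s) * frac_int b f s = indicator {0..} s *\<^sub>R (frac_kernel a (t - s) * frac_int b f s)"
    proof (cases "0 \<le> s")
      case False
      then have "(\<lambda>u. indicator {0..} u *\<^sub>R (frac_kernel b (s - u) * f u)) = (\<lambda>u. 0)"
        by (auto simp: fun_eq_iff frac_kernel_def indicator_def)
      then have "frac_int b f s = 0" by (simp only: frac_int_def set_lebesgue_integral_def) simp
      then show ?thesis by simp
    qed auto
    finally show "(LINT u|lebesgue. F s u) = indicator {0..} s *\<^sub>R (frac_kernel a (t - s) * frac_int b f s)" .
  qed
  also have "\<dots> = frac_int a (frac_int b f) t"
    by (simp add: frac_int_def set_lebesgue_integral_def)
  finally show ?thesis ..
qed

lemma frac_int_cong_AE:
  assumes "set_borel_measurable lebesgue {0..} f" "set_borel_measurable lebesgue {0..} g"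
    and eq: "\<And>u. 0 < u \<Longrightarrow> u < t \<Longrightarrow> f u = g u"
  shows "frac_int a f t = frac_int a g t"
proof -
  have m: "(\<lambda>u. indicator {0..} u *\<^sub>R (frac_kernel a (t - u) * h u)) \<in> borel_measurable lebesgue"
    if "set_borel_measurable lebesgue {0..} h" for h
    using borel_measurable_times[OF frac_kernel_measurable_lebesgue[of a t] that[unfolded set_borel_measurable_def]]
    by (simp add: mult.left_commute)
  have "AE u in lebesgue. u \<noteq> (0::real)"
    by (intro AE_completion AE_lborel_singleton)
  then have "AE u in lebesgue. indicator {0..} u *\<^sub>R (frac_kernel a (t - u) * f u)
      = indicator {0..} u *\<^sub>R (frac_kernel a (t - u) * g u)"
    by eventually_elim (auto simp: indicator_def frac_kernel_def eq)
  then show ?thesis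
    unfolding frac_int_def set_lebesgue_integral_def by (rule integral_cong_AE[OF m[OF assms(1)] m[OF assms(2)]])
qed

section \<open>From the Caputo derivative to a Volterra equation\<close>

lemma locally_absolutely_continuous_imp_continuous:
  assumes "locally_absolutely_continuous f"
  shows "continuous_on {0..} f"
  unfolding continuous_on_eq_continuous_within
proof
  fix x :: real assume x: "x \<in> {0..}"
  have i: "set_integrable lebesgue {0..t} (deriv f)" and e: "f t = f 0 + (LINT s:{0..t}|lebesgue. deriv f s)"
    if "0 \<le> t" for t
    using assms that unfolding locally_absolutely_continuous_def by blast+
  have "continuous_on {0..x + 1} (\<lambda>t. f 0 + integral {0..t} (deriv f))"
    using set_lebesgue_integral_eq_integral(1)[OF i, of "x + 1"] x
    by (intro continuous_intros indefinite_integral_continuous_1) auto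
  then have "continuous_on {0..x + 1} f"
  proof (rule continuous_on_eq)
    fix t assume "t \<in> {0..x + 1}"
    then have "0 \<le> t" by simp
    then show "f 0 + integral {0..t} (deriv f) = f t"
      by (subst e, assumption) (simp only: set_lebesgue_integral_eq_integral(2)[OF i])
  qed
  then have "\<forall>y\<in>{0..x + 1}. continuous (at y within {0..x + 1}) f"
    by (simp only: continuous_on_eq_continuous_within)
  moreover have "x \<in> {0..x + 1}" using x by simp
  ultimately have "continuous (at x within {0..x + 1}) f" by (rule bspec)
  moreover have "at x within {0..x + 1} = at x within {0..}"
    by (rule at_within_nhd[of x "{..<x + 1}"]) auto
  ultimately show "continuous (at x within {0..}) f" by (simp only:)
qed

lemma continuous_on_imp_set_borel_measurable_lebesgue:
  fixes f :: "real \<Rightarrow> real"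
  assumes "continuous_on {0..} f"
  shows "set_borel_measurable lebesgue {0..} f"
  using borel_measurable_continuous_on_indicator[OF _ assms]
  unfolding set_borel_measurable_def by (intro measurable_completion) auto

text \<open>
  Integrating a Caputo equation: for \<open>\<alpha> < 1\<close> the left-hand side is \<open>I (1 - \<alpha>) f'\<close>, and
  \<open>I \<alpha> (I (1 - \<alpha>) f') = I 1 f' = f - f 0\<close> by the semigroup law.
\<close>

lemma caputo_imp_volterra:
  assumes \<alpha>: "0 < \<alpha>" "\<alpha> \<le> 1"
    and ac: "locally_absolutely_continuous f"
    and D: "\<And>t. 0 < t \<Longrightarrow> has_caputo_derivative \<alpha> f (r t) t"
    and r: "set_borel_measurable lebesgue {0..} r"
    and t: "0 \<le> t"
  shows "f t = f 0 + frac_int \<alpha> r t"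
proof -
  have di: "set_integrable lebesgue {0..t} (deriv f)" and ft: "f t = f 0 + (LINT s:{0..t}|lebesgue. deriv f s)"
    using ac t unfolding locally_absolutely_continuous_def by blast+
  \<comment> \<open>The derivative is cut off at \<open>t\<close>, since it need only be locally integrable.\<close>
  define g where "g = (\<lambda>u. indicator {0..t} u * deriv f u)"
  have gi: "integrable lebesgue g" using di by (simp add: set_integrable_def g_def)
  have ind: "indicator {0..} u *\<^sub>R g u = g u" for u by (simp add: g_def indicator_def)
  have gm: "set_borel_measurable lebesgue {0..} g"
    using gi by (simp only: set_borel_measurable_def ind borel_measurable_integrable)
  have k1: "frac_kernel 1 x = (if 0 < x then 1 else 0)" for x by (simp add: frac_kernel_def)
  have gk: "set_integrable lebesgue {0..} (\<lambda>u. frac_kernel 1 (t - u) * g u)"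
    unfolding set_integrable_def
  proof (rule Bochner_Integration.integrable_bound[OF gi])
    have "(\<lambda>u. indicator {0..} u *\<^sub>R (frac_kernel 1 (t - u) * g u)) = (\<lambda>u. frac_kernel 1 (t - u) * g u)"
      by (simp add: g_def indicator_def fun_eq_iff)
    then show "(\<lambda>u. indicator {0..} u *\<^sub>R (frac_kernel 1 (t - u) * g u)) \<in> borel_measurable lebesgue"
      using gi by (simp add: borel_measurable_integrable)
  qed (auto simp: k1 indicator_def)
  have "AE u in lebesgue. u \<noteq> t"
    by (intro AE_completion AE_lborel_singleton)
  then have "frac_int 1 g t = (LINT u|lebesgue. g u)"
    unfolding frac_int_def set_lebesgue_integral_def
    using gk gi by (intro integral_cong_AE)
      (auto simp: set_integrable_def k1 g_def indicator_def elim!: eventually_mono)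
  then have 1: "f t = f 0 + frac_int 1 g t"
    using ft by (simp add: set_lebesgue_integral_def g_def)
  show ?thesis
  proof (cases "\<alpha> = 1")
    case True
    have "frac_int 1 r t = frac_int 1 g t"
      using D by (intro frac_int_cong_AE r gm)
        (auto simp: g_def has_caputo_derivative_def True intro!: DERIV_imp_deriv[symmetric])
    with 1 show ?thesis by (simp add: True)
  next
    case False
    then have \<alpha>1: "0 < 1 - \<alpha>" using \<alpha> by simp
    have "frac_int \<alpha> (frac_int (1 - \<alpha>) g) t = frac_int 1 g t"
      using frac_int_frac_int[OF \<alpha>(1) \<alpha>1 gm, of t] gk by simp
    moreover have "frac_int \<alpha> r t = frac_int \<alpha> (frac_int (1 - \<alpha>) g) t"
    proof (intro frac_int_cong_AE r)
      show "set_borel_measurable lebesgue {0..} (frac_int (1 - \<alpha>) g)"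
        using frac_int_measurable[OF gm, of "1 - \<alpha>"] by (simp add: set_borel_measurable_def)
      fix s assume s: "0 < s" "s < t"
      have "r s = 1 / Gamma (1 - \<alpha>) * (LINT u:{0..s}|lebesgue. deriv f u / (s - u) powr \<alpha>)"
        using D[OF s(1)] False by (simp add: has_caputo_derivative_def)
      also have "\<dots> = (LINT u:{0..s}|lebesgue. 1 / Gamma (1 - \<alpha>) * (deriv f u / (s - u) powr \<alpha>))"
        by (rule set_integral_mult_right[symmetric])
      also have "\<dots> = frac_int (1 - \<alpha>) g s"
        unfolding frac_int_def set_lebesgue_integral_def
        using s by (intro Bochner_Integration.integral_cong refl)
          (auto simp: indicator_def g_def frac_kernel_def powr_minus field_simps)
      finally show "r s = frac_int (1 - \<alpha>) g s" .
    qed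
    ultimately show ?thesis using 1 by simp
  qed
qed

section \<open>Mittag-Leffler solutions of linear Volterra equations\<close>

lemma frac_kernel_le:
  assumes a: "0 < a" and s: "0 < s"
  shows "frac_kernel (a + 1) t \<le> s powr - a * exp (s * t)"
  using frac_int_bound[OF a s exp_bounded_const[of s 1], of t] frac_int_const[OF a, of 1 t] s by simp

text \<open>With first parameter \<open>1\<close> this is the classical two-parameter Mittag-Leffler function.\<close>

lemma mittag_leffler_one:
  "mittag_leffler 1 \<beta> \<gamma> w = (\<Sum>r. w ^ r / Gamma (\<beta> * real r + \<gamma>))" for w :: real
proof -
  have G: "Gamma (1 + real r) = fact r" for r using Gamma_fact[of r, where 'a = real] by simp
  show ?thesis unfolding mittag_leffler_def by (simp add: G)
qed

lemma mittag_leffler_kernel_sums: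
  assumes \<alpha>: "0 < \<alpha>" and \<gamma>: "0 < \<gamma>" and s: "0 < s" and \<xi>: "\<bar>\<xi>\<bar> * s powr - \<alpha> < 1" and x: "0 < x"
  shows "(\<lambda>r. (- \<xi>) ^ r * frac_kernel (real r * \<alpha> + \<gamma>) x) sums
    (x powr (\<gamma> - 1) * mittag_leffler 1 \<alpha> \<gamma> (- \<xi> * x powr \<alpha>))"
proof -
  define q where "q = \<bar>\<xi>\<bar> * s powr - \<alpha>"
  have q: "0 \<le> q" "q < 1" using \<xi> by (auto simp: q_def)
  define K where "K = (\<alpha> + \<gamma>) / x * s powr - \<gamma> * exp (s * x)"
  have sm: "summable (\<lambda>r. (- \<xi>) ^ r * frac_kernel (real r * \<alpha> + \<gamma>) x)"
  proof (rule summable_comparison_test')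
    show "summable (\<lambda>r. K * (real (Suc r) * q ^ r))"
      using geometric_deriv_sums[of q] q by (intro summable_mult) (auto simp: sums_iff)
    fix r :: nat
    let ?a = "real r * \<alpha> + \<gamma>"
    have a: "0 < ?a" using \<alpha> \<gamma> by (simp add: add_nonneg_pos)
    \<comment> \<open>The kernel of order \<open>?a\<close> can be unbounded near zero; one order higher the uniform bound
      \<open>frac_kernel_le\<close> is available.\<close>
    have "frac_kernel ?a x = ?a / x * frac_kernel (?a + 1) x"
      using a x Gamma_real_pos[OF a] by (simp add: frac_kernel_def Gamma_plus1[of ?a] powr_diff nonpos_Ints_def)
    also have "\<dots> \<le> ((\<alpha> + \<gamma>) * real (Suc r)) / x * (s powr - ?a * exp (s * x))"
      using a x \<alpha> \<gamma> frac_kernel_le[OF a s, of x] frac_kernel_nonneg[of "?a + 1" x]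
      by (intro mult_mono divide_right_mono) (auto simp: algebra_simps intro: add_nonneg_nonneg)
    also have "s powr - ?a = (s powr - \<alpha>) ^ r * s powr - \<gamma>"
      using s by (simp add: powr_power powr_add[symmetric] algebra_simps)
    finally have "\<bar>\<xi>\<bar> ^ r * frac_kernel ?a x \<le> \<bar>\<xi>\<bar> ^ r * (((\<alpha> + \<gamma>) * real (Suc r)) / x * ((s powr - \<alpha>) ^ r * s powr - \<gamma> * exp (s * x)))"
      by (intro mult_left_mono) auto
    also have "\<dots> = K * (real (Suc r) * q ^ r)"
      by (simp add: K_def q_def power_mult_distrib mult_ac)
    finally show "norm ((- \<xi>) ^ r * frac_kernel ?a x) \<le> K * (real (Suc r) * q ^ r)"
      using a by (simp add: abs_mult power_abs frac_kernel_nonneg)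
  qed
  have eq: "(- \<xi>) ^ r * frac_kernel (real r * \<alpha> + \<gamma>) x
      = x powr (\<gamma> - 1) * ((- \<xi> * x powr \<alpha>) ^ r / Gamma (\<alpha> * real r + \<gamma>))" for r
  proof -
    have "x powr (real r * \<alpha> + \<gamma> - 1) = x powr (\<gamma> - 1) * (x powr \<alpha>) ^ r"
      using x by (simp add: powr_power powr_add[symmetric] algebra_simps)
    moreover have "(- \<xi> * x powr \<alpha>) ^ r = (- \<xi>) ^ r * (x powr \<alpha>) ^ r" by (rule power_mult_distrib)
    ultimately show ?thesis using x by (simp add: frac_kernel_def mult_ac del: minus_mult_left)
  qed
  have "(\<lambda>r. (- \<xi> * x powr \<alpha>) ^ r / Gamma (\<alpha> * real r + \<gamma>)) sums mittag_leffler 1 \<alpha> \<gamma> (- \<xi> * x powr \<alpha>)"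
    unfolding mittag_leffler_one
  proof (rule summable_sums)
    have "summable (\<lambda>r. x powr (\<gamma> - 1) * ((- \<xi> * x powr \<alpha>) ^ r / Gamma (\<alpha> * real r + \<gamma>)))"
      using sm by (simp only: eq)
    then show "summable (\<lambda>r. (- \<xi> * x powr \<alpha>) ^ r / Gamma (\<alpha> * real r + \<gamma>))"
      using x by (simp only: summable_cmult_iff) simp
  qed
  then show ?thesis unfolding eq by (rule sums_mult)
qed

text \<open>
  Convolution with the Mittag-Leffler kernel is the Neumann series of fractional integrals, which
  converges by the norm bound \<open>s powr - \<alpha>\<close>.
\<close>

lemma mittag_leffler_convolution_sums:
  assumes \<alpha>: "0 < \<alpha>" and s: "0 < s" and \<xi>: "\<bar>\<xi>\<bar> * s powr - \<alpha> < 1" and f: "exp_bounded s C f"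
  shows "(\<lambda>k. (- \<xi>) ^ k * frac_int (real (Suc k) * \<alpha>) f t) sums
    time_convolution f (\<lambda>x. x powr (\<alpha> - 1) * mittag_leffler 1 \<alpha> \<alpha> (- \<xi> * x powr \<alpha>)) t"
proof -
  let ?G = "\<lambda>k u. indicator {0..} u *\<^sub>R (frac_kernel (real (Suc k) * \<alpha>) (t - u) * f u)"
  let ?e = "\<lambda>x. x powr (\<alpha> - 1) * mittag_leffler 1 \<alpha> \<alpha> (- \<xi> * x powr \<alpha>)"
  have a: "0 < real (Suc k) * \<alpha>" for k using \<alpha> by simp
  have *: "(\<lambda>k. (- \<xi>) ^ k * ?G k u) sums (indicator {0..t} u *\<^sub>R (f u * ?e (t - u)))"
    and **: "summable (\<lambda>k. norm ((- \<xi>) ^ k * ?G k u))" for u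
  proof -
    have "(\<lambda>k. (- \<xi>) ^ k * ?G k u) sums (indicator {0..t} u *\<^sub>R (f u * ?e (t - u))) \<and>
        summable (\<lambda>k. norm ((- \<xi>) ^ k * ?G k u))"
    proof (cases "0 \<le> u \<and> u < t")
      case True
      \<comment> \<open>Needed for \<open>\<xi>\<close> itself, and for \<open>- \<bar>\<xi>\<bar>\<close> to see absolute convergence.\<close>
      have 1: "(\<lambda>k. (- \<zeta>) ^ k * frac_kernel (real (Suc k) * \<alpha>) (t - u)) sums
          ((t - u) powr (\<alpha> - 1) * mittag_leffler 1 \<alpha> \<alpha> (- \<zeta> * (t - u) powr \<alpha>))" if "\<bar>\<zeta>\<bar> = \<bar>\<xi>\<bar>" for \<zeta>
        using mittag_leffler_kernel_sums[OF \<alpha> \<alpha> s, of \<zeta> "t - u"] True \<xi> that by (simp add: algebra_simps)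
      have "norm ((- \<xi>) ^ k * ?G k u) = (- (- \<bar>\<xi>\<bar>)) ^ k * frac_kernel (real (Suc k) * \<alpha>) (t - u) * \<bar>f u\<bar>" for k
        using True a[of k] by (simp add: abs_mult power_abs frac_kernel_nonneg del: of_nat_Suc)
      then show ?thesis
        using sums_mult2[OF 1[of \<xi>], of "f u"] sums_summable[OF sums_mult2[OF 1[of "- \<bar>\<xi>\<bar>"], of "\<bar>f u\<bar>"]] True
        by (simp add: mult_ac del: of_nat_Suc)
    next
      case False
      then have "?G k u = 0" for k by (auto simp: indicator_def frac_kernel_def)
      moreover have "indicator {0..t} u *\<^sub>R (f u * ?e (t - u)) = 0"
        using False by (auto simp: indicator_def)
      ultimately show ?thesis by (simp only: mult_zero_right) simp
    qed
    then show "(\<lambda>k. (- \<xi>) ^ k * ?G k u) sums (indicator {0..t} u *\<^sub>R (f u * ?e (t - u)))"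
      "summable (\<lambda>k. norm ((- \<xi>) ^ k * ?G k u))" by auto
  qed
  have "(\<lambda>k. LINT u|lebesgue. (- \<xi>) ^ k * ?G k u) sums (LINT u|lebesgue. (\<Sum>k. (- \<xi>) ^ k * ?G k u))"
  proof (rule sums_integral)
    show "integrable lebesgue (\<lambda>u. (- \<xi>) ^ k * ?G k u)" for k
      using set_integrable_frac_int[OF a s f, of k t] unfolding set_integrable_def
      by (rule integrable_mult_right)
    show "AE u in lebesgue. summable (\<lambda>k. norm ((- \<xi>) ^ k * ?G k u))"
      by (intro always_eventually allI **)
    show "summable (\<lambda>k. LINT u|lebesgue. norm ((- \<xi>) ^ k * ?G k u))"
    proof (rule summable_comparison_test')
      show "summable (\<lambda>k. (C * (s powr - \<alpha> * exp (s * t))) * (\<bar>\<xi>\<bar> * s powr - \<alpha>) ^ k)"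
        using \<xi> by (intro summable_mult summable_geometric) (simp add: abs_mult)
      fix k :: nat
      have "(LINT u|lebesgue. norm ((- \<xi>) ^ k * ?G k u)) = (LINT u|lebesgue. \<bar>\<xi>\<bar> ^ k * norm (?G k u))"
        by (simp only: real_norm_def abs_mult power_abs abs_minus_cancel)
      also have "\<dots> = \<bar>\<xi>\<bar> ^ k * (LINT u|lebesgue. norm (?G k u))"
        by (rule integral_mult_right_zero)
      also have "\<dots> \<le> \<bar>\<xi>\<bar> ^ k * (C * (s powr - (real (Suc k) * \<alpha>) * exp (s * t)))"
        by (intro mult_left_mono frac_int_norm_bound[OF a s f]) auto
      also have "s powr - (real (Suc k) * \<alpha>) = s powr - \<alpha> * (s powr - \<alpha>) ^ k"
        using s by (simp add: powr_power powr_add[symmetric] algebra_simps)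
      finally show "norm (LINT u|lebesgue. norm ((- \<xi>) ^ k * ?G k u))
          \<le> (C * (s powr - \<alpha> * exp (s * t))) * (\<bar>\<xi>\<bar> * s powr - \<alpha>) ^ k"
        by (simp add: power_mult_distrib mult_ac integral_nonneg_AE)
    qed
  qed
  also have "(\<lambda>k. LINT u|lebesgue. (- \<xi>) ^ k * ?G k u) = (\<lambda>k. (- \<xi>) ^ k * frac_int (real (Suc k) * \<alpha>) f t)"
    unfolding frac_int_def set_lebesgue_integral_def by (intro ext integral_mult_right_zero)
  also have "(LINT u|lebesgue. (\<Sum>k. (- \<xi>) ^ k * ?G k u)) = time_convolution f ?e t"
    using sums_unique[OF *] by (simp add: time_convolution_def set_lebesgue_integral_def)
  finally show ?thesis .
qed

text \<open>The equation of \<open>m\<close> substituted \<open>n\<close> times into itself, with the remainder.\<close>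

lemma volterra_iterate:
  assumes \<alpha>: "0 < \<alpha>" and s: "0 < s" and m: "exp_bounded s C m" and g: "exp_bounded s D g"
    and eq: "\<And>t. 0 \<le> t \<Longrightarrow> m t = c + frac_int \<alpha> (\<lambda>u. g u + (- \<xi>) * m u) t"
    and t: "0 < t"
  shows "m t = (\<Sum>k<Suc n. (- \<xi>) ^ k * (c * frac_kernel (real k * \<alpha> + 1) t + frac_int (real (Suc k) * \<alpha>) g t))
    + (- \<xi>) ^ Suc n * frac_int (real (Suc n) * \<alpha>) m t"
proof -
  have eq': "m t = c + (frac_int \<alpha> g t + (- \<xi>) * frac_int \<alpha> m t)" if "0 \<le> t" for t
    using eq[OF that] frac_int_add[OF \<alpha> s g exp_bounded_cmult[OF m, of "- \<xi>"], of t]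
    by (simp only: frac_int_cmult)
  show ?thesis
  proof (induction n)
    case 0
    show ?case using eq'[of t] t by (simp add: frac_kernel_def)
  next
    case (Suc n)
    let ?a = "real (Suc n) * \<alpha>"
    have a: "0 < ?a" using \<alpha> by simp
    have a': "?a + \<alpha> = real (Suc (Suc n)) * \<alpha>" by (simp add: algebra_simps)
    note Ig = exp_bounded_frac_int[OF \<alpha> s g] and Im = exp_bounded_frac_int[OF \<alpha> s m]
    have sg: "frac_int ?a (frac_int \<alpha> h) t = frac_int (real (Suc (Suc n)) * \<alpha>) h t" if "exp_bounded s B h" for h B
      unfolding a'[symmetric] using that
      by (intro frac_int_frac_int[OF a \<alpha>] set_integrable_frac_int[OF add_pos_pos[OF a \<alpha>] s that])
        (simp add: exp_bounded_def)
    have "frac_int ?a m t = frac_int ?a (\<lambda>t. c + (frac_int \<alpha> g t + (- \<xi>) * frac_int \<alpha> m t)) t"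
      by (rule frac_int_cong) (rule eq')
    also have "\<dots> = frac_int ?a (\<lambda>t. c) t + frac_int ?a (\<lambda>t. frac_int \<alpha> g t + (- \<xi>) * frac_int \<alpha> m t) t"
      by (rule frac_int_add[OF a s exp_bounded_const exp_bounded_add[OF Ig exp_bounded_cmult[OF Im]]])
        (use s in simp)
    also have "frac_int ?a (\<lambda>t. frac_int \<alpha> g t + (- \<xi>) * frac_int \<alpha> m t) t
        = frac_int ?a (frac_int \<alpha> g) t + (- \<xi>) * frac_int ?a (frac_int \<alpha> m) t"
      by (subst frac_int_add[OF a s Ig exp_bounded_cmult[OF Im]]) (simp only: frac_int_cmult)
    finally have "frac_int ?a m t = c * frac_kernel (?a + 1) t
        + (frac_int (real (Suc (Suc n)) * \<alpha>) g t + (- \<xi>) * frac_int (real (Suc (Suc n)) * \<alpha>) m t)"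
      by (simp only: frac_int_const[OF a] sg[OF g] sg[OF m])
    then show ?case using Suc.IH
      by (simp only: sum.lessThan_Suc[of _ "Suc n"]) (simp add: algebra_simps del: of_nat_Suc sum.lessThan_Suc)
  qed
qed

text \<open>
  A solution of exponential growth of the Volterra equation \<open>m = c + I \<alpha> (g - \<xi> * m)\<close> is given by
  the variation of constants formula with Mittag-Leffler functions; in particular it is unique.
\<close>

lemma volterra_mittag_leffler:
  assumes \<alpha>: "0 < \<alpha>" and s: "0 < s" and \<xi>: "\<bar>\<xi>\<bar> * s powr - \<alpha> < 1"
    and m: "exp_bounded s C m" and g: "exp_bounded s D g"
    and eq: "\<And>t. 0 \<le> t \<Longrightarrow> m t = c + frac_int \<alpha> (\<lambda>u. g u + (- \<xi>) * m u) t"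
    and t: "0 < t"
  shows "m t = c * mittag_leffler 1 \<alpha> 1 (- \<xi> * t powr \<alpha>)
    + time_convolution g (\<lambda>x. x powr (\<alpha> - 1) * mittag_leffler 1 \<alpha> \<alpha> (- \<xi> * x powr \<alpha>)) t"
proof -
  let ?S = "\<lambda>k. (- \<xi>) ^ k * (c * frac_kernel (real k * \<alpha> + 1) t + frac_int (real (Suc k) * \<alpha>) g t)"
  let ?R = "\<lambda>n. (- \<xi>) ^ Suc n * frac_int (real (Suc n) * \<alpha>) m t"
  have "?R \<longlonglongrightarrow> 0"
  proof (rule tendsto_rabs_zero_cancel[OF tendsto_sandwich[OF _ _ tendsto_const]])
    show "(\<lambda>n. C * exp (s * t) * (\<bar>\<xi>\<bar> * s powr - \<alpha>) ^ Suc n) \<longlonglongrightarrow> 0"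
      using \<xi> by (intro tendsto_mult_right_zero LIMSEQ_Suc LIMSEQ_power_zero) (simp add: abs_mult)
    show "\<forall>\<^sub>F n in sequentially. 0 \<le> \<bar>?R n\<bar>" by simp
    show "\<forall>\<^sub>F n in sequentially. \<bar>?R n\<bar> \<le> C * exp (s * t) * (\<bar>\<xi>\<bar> * s powr - \<alpha>) ^ Suc n"
    proof (intro always_eventually allI)
      fix n
      have "\<bar>?R n\<bar> = \<bar>\<xi>\<bar> ^ Suc n * \<bar>frac_int (real (Suc n) * \<alpha>) m t\<bar>"
        by (simp only: abs_mult power_abs abs_minus_cancel)
      also have "\<dots> \<le> \<bar>\<xi>\<bar> ^ Suc n * (C * (s powr - (real (Suc n) * \<alpha>) * exp (s * t)))"
        using \<alpha> by (intro mult_left_mono frac_int_bound[OF _ s m]) auto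
      also have "s powr - (real (Suc n) * \<alpha>) = (s powr - \<alpha>) ^ Suc n"
        using s by (subst powr_power) (auto simp: mult.commute)
      finally show "\<bar>?R n\<bar> \<le> C * exp (s * t) * (\<bar>\<xi>\<bar> * s powr - \<alpha>) ^ Suc n"
        by (simp only: power_mult_distrib mult_ac)
    qed
  qed
  then have "(\<lambda>n. m t - ?R n) \<longlonglongrightarrow> m t - 0" by (intro tendsto_diff tendsto_const)
  also have "(\<lambda>n. m t - ?R n) = (\<lambda>n. \<Sum>k<Suc n. ?S k)"
  proof
    fix n show "m t - ?R n = (\<Sum>k<Suc n. ?S k)"
      using volterra_iterate[OF \<alpha> s m g eq t, of n] by (simp only: add_diff_cancel_right')
  qed
  finally have "?S sums m t"
    unfolding sums_def using LIMSEQ_imp_Suc[of "\<lambda>n. \<Sum>k<n. ?S k" "m t"] by simp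
  moreover have "?S sums (c * mittag_leffler 1 \<alpha> 1 (- \<xi> * t powr \<alpha>)
    + time_convolution g (\<lambda>x. x powr (\<alpha> - 1) * mittag_leffler 1 \<alpha> \<alpha> (- \<xi> * x powr \<alpha>)) t)"
    using sums_add[OF sums_mult[OF mittag_leffler_kernel_sums[OF \<alpha> zero_less_one s \<xi> t], of c]
        mittag_leffler_convolution_sums[OF \<alpha> s \<xi> g, of t]] t
    by (simp add: distrib_left mult.left_commute[of c] del: of_nat_Suc)
  ultimately show ?thesis by (rule sums_unique2)
qed

lemma time_convolution_const_plus:
  assumes \<alpha>: "0 < \<alpha>" and s: "0 < s" and \<xi>: "\<bar>\<xi>\<bar> * s powr - \<alpha> < 1" "\<xi> \<noteq> 0" and f: "exp_bounded s C f"
    and t: "0 < t"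
  defines "e \<equiv> \<lambda>x. x powr (\<alpha> - 1) * mittag_leffler 1 \<alpha> \<alpha> (- \<xi> * x powr \<alpha>)"
  shows "time_convolution (\<lambda>u. a + b * f u) e t
    = a / \<xi> * (1 - mittag_leffler 1 \<alpha> 1 (- \<xi> * t powr \<alpha>)) + b * time_convolution f e t"
proof -
  let ?E = "mittag_leffler 1 \<alpha> 1 (- \<xi> * t powr \<alpha>)"
  have g: "exp_bounded s (\<bar>a\<bar> + \<bar>b\<bar> * C) (\<lambda>u. a + b * f u)"
    using s by (intro exp_bounded_add exp_bounded_const exp_bounded_cmult f) auto
  have p: "0 < real (Suc k) * \<alpha>" for k using \<alpha> by simp
  have "(\<lambda>k. (- \<xi>) ^ k * frac_kernel (real k * \<alpha> + 1) t) sums ?E"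
    using mittag_leffler_kernel_sums[OF \<alpha> zero_less_one s \<xi>(1) t] t by simp
  \<comment> \<open>The fractional integral of order \<open>(k + 1) * \<alpha>\<close> of a constant is a multiple of term \<open>k + 1\<close> of
    this series.\<close>
  then have "(\<lambda>k. (- \<xi>) ^ Suc k * frac_kernel (real (Suc k) * \<alpha> + 1) t) sums (?E - 1)"
    using t by (subst sums_Suc_iff) (simp add: frac_kernel_def)
  from sums_mult[OF this, of "- a / \<xi>"]
  have "(\<lambda>k. - a / \<xi> * ((- \<xi>) ^ Suc k * frac_kernel (real (Suc k) * \<alpha> + 1) t)) sums (- a / \<xi> * (?E - 1))" .
  also have "(\<lambda>k. - a / \<xi> * ((- \<xi>) ^ Suc k * frac_kernel (real (Suc k) * \<alpha> + 1) t))
      = (\<lambda>k. (- \<xi>) ^ k * (a * frac_kernel (real (Suc k) * \<alpha> + 1) t))"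
    using \<xi>(2) by (simp add: fun_eq_iff del: of_nat_Suc)
  also have "- a / \<xi> * (?E - 1) = a / \<xi> * (1 - ?E)"
    by (simp add: algebra_simps)
  finally have 1: "(\<lambda>k. (- \<xi>) ^ k * (a * frac_kernel (real (Suc k) * \<alpha> + 1) t)) sums (a / \<xi> * (1 - ?E))" .
  have "(- \<xi>) ^ k * frac_int (real (Suc k) * \<alpha>) (\<lambda>u. a + b * f u) t =
     (- \<xi>) ^ k * (a * frac_kernel (real (Suc k) * \<alpha> + 1) t) + b * ((- \<xi>) ^ k * frac_int (real (Suc k) * \<alpha>) f t)" for k
    using s by (subst frac_int_add[OF p s exp_bounded_const exp_bounded_cmult[OF f]])
      (simp_all add: frac_int_const[OF p] frac_int_cmult distrib_left mult.left_commute del: of_nat_Suc)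
  then have "(\<lambda>k. (- \<xi>) ^ k * frac_int (real (Suc k) * \<alpha>) (\<lambda>u. a + b * f u) t) sums
      (a / \<xi> * (1 - ?E) + b * time_convolution f e t)"
    using sums_add[OF 1 sums_mult[OF mittag_leffler_convolution_sums[OF \<alpha> s \<xi>(1) f, of t], of b]]
    by (simp add: e_def del: of_nat_Suc)
  then show ?thesis
    using mittag_leffler_convolution_sums[OF \<alpha> s \<xi>(1) g, of t] sums_unique2 unfolding e_def by blast
qed

section \<open>Decay of the transition probabilities and the equation of the mean\<close>

text \<open>
  A family of probability distributions \<open>\<lambda>n. p n t\<close>, \<open>t \<ge> 0\<close>, that satisfies the integrated
  equations of the fractional queue started in \<open>i\<close>. The equation for \<open>n = 0\<close> is left out: in the
  mean it is multiplied by zero.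
\<close>

locale volterra_queue =
  fixes p :: "nat \<Rightarrow> real \<Rightarrow> real" and \<alpha> lam \<mu> \<xi> :: real and i :: nat
  assumes \<alpha>: "0 < \<alpha>" and rates: "0 < lam" "0 < \<mu>" "0 \<le> \<xi>"
    and p_measurable: "\<And>n. set_borel_measurable lebesgue {0..} (p n)"
    and p_nonneg: "\<And>n t. 0 \<le> t \<Longrightarrow> 0 \<le> p n t"
    and p_sums: "\<And>t. 0 \<le> t \<Longrightarrow> (\<lambda>n. p n t) sums 1"
    and volterra: "\<And>n t. 1 \<le> n \<Longrightarrow> 0 \<le> t \<Longrightarrow> p n t = (if i = n then 1 else 0)
      + frac_int \<alpha> (\<lambda>u. - (lam + \<mu> + \<xi>) * p n u + lam * p (n - 1) u + \<mu> * p (n + 1) u) t"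
begin

text \<open>
  The exponent of the weight, chosen such that the norm \<open>growth powr - \<alpha>\<close> of fractional integration
  is half the reciprocal of the total rate \<open>lam + \<mu> + \<xi>\<close>.
\<close>

definition growth :: real where
  "growth = (2 * (lam + \<mu> + \<xi>)) powr (1 / \<alpha>)"

lemma growth_pos: "0 < growth"
  using rates by (simp add: growth_def)

lemma growth_powr: "growth powr - \<alpha> = 1 / (2 * (lam + \<mu> + \<xi>))"
  using rates \<alpha> by (simp add: growth_def powr_powr powr_minus divide_inverse)

lemma one_le_exp_growth: "0 \<le> t \<Longrightarrow> 1 \<le> exp (growth * t)"
  using growth_pos by simp

lemma p_le_1:
  assumes "0 \<le> t" shows "p n t \<le> 1"
  using sum_le_suminf[of "\<lambda>n. p n t" "{n}"] p_sums[OF assms] p_nonneg[OF assms]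
  by (simp add: sums_iff)

lemma p_exp_bounded: "exp_bounded growth 1 (p n)"
proof (rule exp_boundedI[OF p_measurable])
  fix u :: real assume "0 \<le> u"
  then show "\<bar>p n u\<bar> \<le> 1 * exp (growth * u)"
    using order_trans[OF p_le_1[of u n] one_le_exp_growth[of u]] p_nonneg[of u n] by simp
qed

lemma rhs_exp_bounded:
  "\<exists>C. exp_bounded growth C (\<lambda>u. - (lam + \<mu> + \<xi>) * p n u + lam * p (n - 1) u + \<mu> * p (n + 1) u)"
  using exp_bounded_add[OF exp_bounded_add[OF exp_bounded_cmult[OF p_exp_bounded] exp_bounded_cmult[OF p_exp_bounded]]
      exp_bounded_cmult[OF p_exp_bounded]] by blast

text \<open>
  Above the initial state the loss term has the right sign and may be dropped, so a bound that holds
  for all states from \<open>i + k\<close> on improves by the factor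
  \<open>(lam + \<mu>) * growth powr - \<alpha> \<le> 1 / 2\<close> from \<open>i + k + 1\<close> on.
\<close>

lemma tail_decay: "i + k \<le> n \<Longrightarrow> 0 \<le> t \<Longrightarrow> p n t \<le> (1 / 2) ^ k * exp (growth * t)"
proof (induction k arbitrary: n t)
  case 0
  then show ?case using order_trans[OF p_le_1[of t n] one_le_exp_growth[of t]] by simp
next
  case (Suc k)
  let ?f = "\<lambda>u. - (lam + \<mu> + \<xi>) * p n u + lam * p (n - 1) u + \<mu> * p (n + 1) u"
  let ?g = "\<lambda>u. lam * p (n - 1) u + \<mu> * p (n + 1) u"
  obtain C where f: "exp_bounded growth C ?f" using rhs_exp_bounded by blast
  have g: "exp_bounded growth ((lam + \<mu>) * (1 / 2) ^ k) ?g"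
  proof (intro exp_boundedI set_borel_measurable_lincomb p_measurable)
    fix u :: real assume u: "0 \<le> u"
    have "lam * p (n - 1) u + \<mu> * p (n + 1) u
        \<le> lam * ((1 / 2) ^ k * exp (growth * u)) + \<mu> * ((1 / 2) ^ k * exp (growth * u))"
      using Suc.IH[of "n - 1" u] Suc.IH[of "n + 1" u] Suc.prems(1) u rates by (intro add_mono mult_left_mono) auto
    moreover have "0 \<le> lam * p (n - 1) u + \<mu> * p (n + 1) u"
      using rates p_nonneg[OF u] by simp
    ultimately show "\<bar>lam * p (n - 1) u + \<mu> * p (n + 1) u\<bar> \<le> (lam + \<mu>) * (1 / 2) ^ k * exp (growth * u)"
      by (simp add: algebra_simps)
  qed
  have "p n t = frac_int \<alpha> ?f t"
    using volterra[of n t] Suc.prems by simp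
  also have "\<dots> \<le> frac_int \<alpha> ?g t"
  proof (rule frac_int_mono[OF \<alpha> growth_pos f g])
    fix u :: real assume "0 \<le> u"
    then have "0 \<le> (lam + \<mu> + \<xi>) * p n u" using rates p_nonneg by simp
    then show "?f u \<le> ?g u" by linarith
  qed
  also have "\<dots> \<le> (lam + \<mu>) * (1 / 2) ^ k * (growth powr - \<alpha> * exp (growth * t))"
    using frac_int_bound[OF \<alpha> growth_pos g, of t] by simp
  also have "\<dots> = (lam + \<mu>) * growth powr - \<alpha> * ((1 / 2) ^ k * exp (growth * t))"
    by simp
  also have "\<dots> \<le> 1 / 2 * ((1 / 2) ^ k * exp (growth * t))"
    using rates by (intro mult_right_mono) (simp_all add: growth_powr field_simps)
  finally show ?case by simp
qed

lemma p_decay: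
  assumes "0 \<le> t" shows "p n t \<le> 2 ^ i * (1 / 2) ^ n * exp (growth * t)"
proof (cases "i \<le> n")
  case True
  then have "(2::real) ^ i * (1 / 2) ^ n = (1 / 2) ^ (n - i)"
    by (simp add: power_diff power_one_over)
  then show ?thesis using tail_decay[of "n - i" n t] True assms by simp
next
  case False
  then have "(1::real) \<le> 2 ^ i * (1 / 2) ^ n"
    by (simp add: power_one_over)
  then have "1 * 1 \<le> 2 ^ i * (1 / 2) ^ n * exp (growth * t)"
    using one_le_exp_growth[OF assms] by (intro mult_mono) auto
  then show ?thesis using p_le_1[OF assms, of n] by linarith
qed

lemma summable_n_half: "summable (\<lambda>n. real n * (2 ^ i * (1 / 2) ^ n))"
proof (rule summable_comparison_test')
  show "summable (\<lambda>n. 2 ^ i * (real (Suc n) * (1 / 2) ^ n))"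
    using geometric_deriv_sums[of "1 / 2 :: real"] by (intro summable_mult) (auto simp: sums_iff)
qed (auto simp: mult_left_mono mult_right_mono)

text \<open>The mean of the distribution \<open>\<lambda>n. p n t\<close>; the series converges for \<open>t \<ge> 0\<close> by \<open>p_decay\<close>.\<close>

definition mean :: "real \<Rightarrow> real" where
  "mean t = (\<Sum>n. real n * p n t)"

lemma exp_bounded_n_p: "exp_bounded growth (real n * (2 ^ i * (1 / 2) ^ n)) (\<lambda>u. real n * p n u)"
proof (rule exp_boundedI)
  show "set_borel_measurable lebesgue {0..} (\<lambda>u. real n * p n u)"
    using set_borel_measurable_lincomb[OF p_measurable p_measurable, of "real n" n 0 n] by simp
  show "\<bar>real n * p n u\<bar> \<le> real n * (2 ^ i * (1 / 2) ^ n) * exp (growth * u)" if "0 \<le> u" for u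
    using p_decay[OF that, of n] p_nonneg[OF that, of n] by (simp add: abs_mult mult.assoc mult_left_mono)
qed

lemma mean_sums:
  assumes "0 \<le> t" shows "(\<lambda>n. real n * p n t) sums mean t"
  unfolding mean_def
proof (rule summable_sums, rule summable_comparison_test')
  show "summable (\<lambda>n. real n * (2 ^ i * (1 / 2) ^ n) * exp (growth * t))"
    by (rule summable_mult2[OF summable_n_half])
  show "norm (real n * p n t) \<le> real n * (2 ^ i * (1 / 2) ^ n) * exp (growth * t)" for n
    using exp_bounded_le[OF exp_bounded_n_p assms] by simp
qed

lemma mean_exp_bounded: "exp_bounded growth (\<Sum>n. real n * (2 ^ i * (1 / 2) ^ n)) mean"
proof (rule exp_boundedI)
  have "(\<lambda>u. \<Sum>n. indicator {0..} u * (real n * p n u)) \<in> borel_measurable lebesgue"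
    by (intro borel_measurable_suminf exp_bounded_measurable[OF exp_bounded_n_p])
  also have "(\<lambda>u. \<Sum>n. indicator {0..} u * (real n * p n u)) = (\<lambda>u. indicator {0..} u *\<^sub>R mean u)"
    by (auto simp: fun_eq_iff indicator_def mean_def)
  finally show "set_borel_measurable lebesgue {0..} mean"
    by (simp add: set_borel_measurable_def)
next
  fix u :: real assume u: "0 \<le> u"
  have "0 \<le> mean u"
    using mean_sums[OF u] p_nonneg[OF u] unfolding mean_def by (intro suminf_nonneg) (auto simp: sums_iff)
  moreover have "mean u \<le> (\<Sum>n. real n * (2 ^ i * (1 / 2) ^ n)) * exp (growth * u)"
    using sums_le[OF _ mean_sums[OF u] sums_mult2[OF summable_sums[OF summable_n_half]]]
      exp_bounded_le[OF exp_bounded_n_p u] by (meson abs_le_D1)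
  ultimately show "\<bar>mean u\<bar> \<le> (\<Sum>n. real n * (2 ^ i * (1 / 2) ^ n)) * exp (growth * u)"
    by simp
qed

text \<open>
  The rate of change of the mean: arrivals contribute \<open>lam\<close>, services \<open>- \<mu> * (1 - p 0 u)\<close>, and a
  catastrophe removes the whole queue.
\<close>

lemma drift_sums:
  assumes "0 \<le> u"
  shows "(\<lambda>n. real n * (- (lam + \<mu> + \<xi>) * p n u + lam * p (n - 1) u + \<mu> * p (n + 1) u)) sums
    (lam - \<mu> + \<mu> * p 0 u + (- \<xi>) * mean u)"
proof -
  have P: "(\<lambda>n. p n u) sums 1" and M: "(\<lambda>n. real n * p n u) sums mean u"
    using p_sums[OF assms] mean_sums[OF assms] .
  have M1: "(\<lambda>n. real (Suc n) * p (Suc n) u) sums mean u"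
    using M by (subst sums_Suc_iff[of "\<lambda>n. real n * p n u"]) simp
  have M2: "(\<lambda>n. real (Suc (Suc n)) * p (Suc (Suc n)) u) sums (mean u - p 1 u)"
    using M1 by (subst sums_Suc_iff[of "\<lambda>n. real (Suc n) * p (Suc n) u"]) simp
  have P1: "(\<lambda>n. p (Suc n) u) sums (1 - p 0 u)"
    using P by (subst sums_Suc_iff[of "\<lambda>n. p n u"]) simp
  have P2: "(\<lambda>n. p (Suc (Suc n)) u) sums (1 - p 0 u - p 1 u)"
    using P1 by (subst sums_Suc_iff[of "\<lambda>n. p (Suc n) u"]) simp
  have "(\<lambda>n. - (lam + \<mu> + \<xi>) * (real (Suc n) * p (Suc n) u) + lam * (real n * p n u + p n u)
      + \<mu> * (real (Suc (Suc n)) * p (Suc (Suc n)) u - p (Suc (Suc n)) u)) sums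
    (- (lam + \<mu> + \<xi>) * mean u + lam * (mean u + 1) + \<mu> * (mean u - p 1 u - (1 - p 0 u - p 1 u)))"
    by (intro sums_add sums_mult sums_diff P M M1 M2 P2)
  also have "(\<lambda>n. - (lam + \<mu> + \<xi>) * (real (Suc n) * p (Suc n) u) + lam * (real n * p n u + p n u)
      + \<mu> * (real (Suc (Suc n)) * p (Suc (Suc n)) u - p (Suc (Suc n)) u))
    = (\<lambda>n. real (Suc n) * (- (lam + \<mu> + \<xi>) * p (Suc n) u + lam * p (Suc n - 1) u + \<mu> * p (Suc n + 1) u))"
    by (simp add: fun_eq_iff algebra_simps)
  also have "- (lam + \<mu> + \<xi>) * mean u + lam * (mean u + 1) + \<mu> * (mean u - p 1 u - (1 - p 0 u - p 1 u))
    = lam - \<mu> + \<mu> * p 0 u + (- \<xi>) * mean u"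
    by (simp add: algebra_simps)
  finally show ?thesis
    by (subst (asm) sums_Suc_iff) simp
qed

lemma rhs_decay:
  assumes n: "1 \<le> n"
  shows "exp_bounded growth ((3 * lam + 2 * \<mu> + \<xi>) * (2 ^ i * (1 / 2) ^ n))
    (\<lambda>u. - (lam + \<mu> + \<xi>) * p n u + lam * p (n - 1) u + \<mu> * p (n + 1) u)"
proof (rule exp_boundedI)
  show "set_borel_measurable lebesgue {0..} (\<lambda>u. - (lam + \<mu> + \<xi>) * p n u + lam * p (n - 1) u + \<mu> * p (n + 1) u)"
    using rhs_exp_bounded[of n] by (auto simp: exp_bounded_def)
  fix u :: real assume u: "0 \<le> u"
  define B where "B = 2 ^ i * (1 / 2) ^ n * exp (growth * u)"
  have B: "0 \<le> B" by (simp add: B_def)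
  have n1: "p (n - 1) u \<le> 2 * B"
    using p_decay[OF u, of "n - 1"] n by (cases n) (auto simp: B_def)
  have n2: "p (n + 1) u \<le> B"
    using p_decay[OF u, of "n + 1"] B p_nonneg[OF u, of "n + 1"] unfolding B_def by simp
  have n0: "p n u \<le> B" using p_decay[OF u, of n] by (simp add: B_def)
  have "\<bar>- (lam + \<mu> + \<xi>) * p n u + lam * p (n - 1) u + \<mu> * p (n + 1) u\<bar>
      \<le> (lam + \<mu> + \<xi>) * p n u + lam * p (n - 1) u + \<mu> * p (n + 1) u"
  proof -
    have "0 \<le> (lam + \<mu> + \<xi>) * p n u" "0 \<le> lam * p (n - 1) u" "0 \<le> \<mu> * p (n + 1) u"
      using rates p_nonneg[OF u] by auto
    then show ?thesis by linarith
  qed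
  also have "\<dots> \<le> (lam + \<mu> + \<xi>) * B + lam * (2 * B) + \<mu> * B"
    using rates n0 n1 n2 by (intro add_mono mult_left_mono) auto
  also have "\<dots> = (3 * lam + 2 * \<mu> + \<xi>) * (2 ^ i * (1 / 2) ^ n) * exp (growth * u)"
    by (simp add: B_def algebra_simps)
  finally show "\<bar>- (lam + \<mu> + \<xi>) * p n u + lam * p (n - 1) u + \<mu> * p (n + 1) u\<bar> \<le> \<dots>" .
qed

lemma mean_volterra:
  assumes t: "0 \<le> t"
  shows "mean t = real i + frac_int \<alpha> (\<lambda>u. lam - \<mu> + \<mu> * p 0 u + (- \<xi>) * mean u) t"
proof -
  let ?r = "\<lambda>n u. - (lam + \<mu> + \<xi>) * p n u + lam * p (n - 1) u + \<mu> * p (n + 1) u"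
  let ?c = "\<lambda>n. real n * ((3 * lam + 2 * \<mu> + \<xi>) * (2 ^ i * (1 / 2) ^ n))"
  have r: "exp_bounded growth (?c n) (\<lambda>u. real n * ?r n u)" for n
  proof (cases "n = 0")
    case True
    then show ?thesis by (simp add: exp_bounded_def set_borel_measurable_def)
  next
    case False
    then show ?thesis using exp_bounded_cmult[OF rhs_decay, of n "real n"] by simp
  qed
  have c: "summable ?c"
    using summable_mult[OF summable_n_half, of "3 * lam + 2 * \<mu> + \<xi>"] by (simp add: mult_ac)
  have "(\<lambda>n. (if n = i then real n else 0) + frac_int \<alpha> (\<lambda>u. real n * ?r n u) t) sums
      (real i + frac_int \<alpha> (\<lambda>u. \<Sum>n. real n * ?r n u) t)"
    by (intro sums_add sums_single frac_int_sums[OF \<alpha> growth_pos r c])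
  also have "(\<lambda>n. (if n = i then real n else 0) + frac_int \<alpha> (\<lambda>u. real n * ?r n u) t) = (\<lambda>n. real n * p n t)"
  proof
    fix n show "(if n = i then real n else 0) + frac_int \<alpha> (\<lambda>u. real n * ?r n u) t = real n * p n t"
    proof (cases "n = 0")
      case False
      then have p: "p n t = (if i = n then 1 else 0) + frac_int \<alpha> (?r n) t"
        by (intro volterra t) simp
      show ?thesis
        unfolding frac_int_cmult[of \<alpha> "real n" "?r n" t] p by (simp add: distrib_left)
    qed (simp add: frac_int_def)
  qed
  also have "frac_int \<alpha> (\<lambda>u. \<Sum>n. real n * ?r n u) t = frac_int \<alpha> (\<lambda>u. lam - \<mu> + \<mu> * p 0 u + (- \<xi>) * mean u) t"
    using sums_unique[OF drift_sums] by (intro frac_int_cong) simp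
  finally show ?thesis using mean_sums[OF t] sums_unique2 by blast
qed

theorem mean_eq:
  assumes \<xi>: "0 < \<xi>" and t: "0 < t"
  shows "mean t = real i * mittag_leffler 1 \<alpha> 1 (- \<xi> * t powr \<alpha>)
      + \<mu> * time_convolution (p 0) (\<lambda>s. s powr (\<alpha> - 1) * mittag_leffler 1 \<alpha> \<alpha> (- \<xi> * s powr \<alpha>)) t
      + (lam - \<mu>) / \<xi> * (1 - mittag_leffler 1 \<alpha> 1 (- \<xi> * t powr \<alpha>))"
proof -
  have q: "\<bar>\<xi>\<bar> * growth powr - \<alpha> < 1"
    using rates by (simp add: growth_powr field_simps)
  have g: "exp_bounded growth (\<bar>lam - \<mu>\<bar> + \<bar>\<mu>\<bar> * 1) (\<lambda>u. lam - \<mu> + \<mu> * p 0 u)"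
    by (intro exp_bounded_add exp_bounded_const exp_bounded_cmult p_exp_bounded less_imp_le growth_pos)
  show ?thesis
    using volterra_mittag_leffler[OF \<alpha> growth_pos q mean_exp_bounded g mean_volterra t]
      time_convolution_const_plus[OF \<alpha> growth_pos q _ p_exp_bounded[of 0] t, of "lam - \<mu>" \<mu>] \<xi>
    by simp
qed

end

section \<open>The expectation of the queue length\<close>

lemma (in prob_space)
  fixes Y :: "'a \<Rightarrow> nat"
  assumes Y: "Y \<in> M \<rightarrow>\<^sub>M count_space UNIV"
  shows prob_eq_sums_1: "(\<lambda>n. \<P>(\<omega> in M. Y \<omega> = n)) sums 1"
    and integrable_nat_valued: "summable (\<lambda>n. real n * \<P>(\<omega> in M. Y \<omega> = n)) \<Longrightarrow> integrable M (\<lambda>\<omega>. real (Y \<omega>))"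
    and expectation_nat_valued: "summable (\<lambda>n. real n * \<P>(\<omega> in M. Y \<omega> = n)) \<Longrightarrow>
      expectation (\<lambda>\<omega>. real (Y \<omega>)) = (\<Sum>n. real n * \<P>(\<omega> in M. Y \<omega> = n))"
proof -
  have ev: "{\<omega> \<in> space M. Y \<omega> = n} \<in> events" for n
    using measurable_sets[OF Y, of "{n}"] by (simp add: vimage_def Int_def conj_commute)
  have "(\<lambda>n. \<P>(\<omega> in M. Y \<omega> = n)) sums prob (\<Union>n. {\<omega> \<in> space M. Y \<omega> = n})"
    using ev by (intro finite_measure_UNION) (auto simp: disjoint_family_on_def)
  also have "(\<Union>n. {\<omega> \<in> space M. Y \<omega> = n}) = space M" by auto
  finally show "(\<lambda>n. \<P>(\<omega> in M. Y \<omega> = n)) sums 1" by (simp add: prob_space)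
  let ?f = "\<lambda>n \<omega>. real n * indicator {\<omega> \<in> space M. Y \<omega> = n} \<omega>"
  have f: "(\<Sum>n. ?f n \<omega>) = real (Y \<omega>)" "summable (\<lambda>n. norm (?f n \<omega>))" if "\<omega> \<in> space M" for \<omega>
  proof -
    have "?f n \<omega> = (if n = Y \<omega> then real n else 0)" for n using that by (auto simp: indicator_def)
    then show "(\<Sum>n. ?f n \<omega>) = real (Y \<omega>)" "summable (\<lambda>n. norm (?f n \<omega>))"
      using sums_single[of "Y \<omega>" real] by (simp_all add: sums_iff if_distrib[of abs] cong: if_cong)
  qed
  assume S: "summable (\<lambda>n. real n * \<P>(\<omega> in M. Y \<omega> = n))"
  have I: "integrable M (?f n)" for n using ev[of n] by (intro integrable_mult_right) (simp add: emeasure_eq_measure)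
  have L: "(LINT \<omega>|M. ?f n \<omega>) = real n * \<P>(\<omega> in M. Y \<omega> = n)" for n using ev[of n] by simp
  have A: "AE \<omega> in M. summable (\<lambda>n. norm (?f n \<omega>))" using f(2) by (intro AE_I2)
  have N: "summable (\<lambda>n. LINT \<omega>|M. norm (?f n \<omega>))"
  proof -
    have "norm (?f n \<omega>) = ?f n \<omega>" for n \<omega> by (simp add: indicator_def)
    then show ?thesis using S by (simp only: L)
  qed
  have eq: "integral\<^sup>L M (\<lambda>\<omega>. \<Sum>n. ?f n \<omega>) = expectation (\<lambda>\<omega>. real (Y \<omega>))"
    by (intro Bochner_Integration.integral_cong refl f)
  show "integrable M (\<lambda>\<omega>. real (Y \<omega>))"
    using integrable_suminf[OF I A N] f(1) by (simp cong: Bochner_Integration.integrable_cong)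
  show "expectation (\<lambda>\<omega>. real (Y \<omega>)) = (\<Sum>n. real n * \<P>(\<omega> in M. Y \<omega> = n))"
    using integral_suminf[OF I A N] by (simp only: eq L)
qed

context fractional_queue_catastrophes
begin

text \<open>When \<open>X 0 = i\<close> almost surely, conditioning on this event changes nothing.\<close>

lemma transition_prob_eq_prob:
  assumes X0: "AE \<omega> in M. X 0 \<omega> = i" and t: "0 \<le> t"
  shows "transition_prob M X i n t = \<P>(\<omega> in M. X t \<omega> = n)"
proof -
  have ev: "{\<omega> \<in> space M. X s \<omega> = n} \<in> events" if "0 \<le> s" for s n
    using measurable_sets[OF process[OF that], of "{n}"] by (simp add: vimage_def Int_def conj_commute)
  have "\<P>(\<omega> in M. X 0 \<omega> = i) = 1"
    using X0 ev[of 0 i] by (simp add: prob_Collect_eq_1)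
  moreover have "\<P>(\<omega> in M. X t \<omega> = n \<and> X 0 \<omega> = i) = \<P>(\<omega> in M. X t \<omega> = n)"
  proof (rule finite_measure_eq_AE)
    show "AE \<omega> in M. (\<omega> \<in> {\<omega> \<in> space M. X t \<omega> = n \<and> X 0 \<omega> = i}) = (\<omega> \<in> {\<omega> \<in> space M. X t \<omega> = n})"
      using X0 by eventually_elim auto
    have "{\<omega> \<in> space M. X t \<omega> = n \<and> X 0 \<omega> = i} = {\<omega> \<in> space M. X t \<omega> = n} \<inter> {\<omega> \<in> space M. X 0 \<omega> = i}"
      by auto
    then show "{\<omega> \<in> space M. X t \<omega> = n \<and> X 0 \<omega> = i} \<in> events" using ev t by auto
  qed (use ev t in auto)
  ultimately show ?thesis by (simp add: transition_prob_def cond_prob_def)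
qed

lemma volterra_queue_transition_prob:
  assumes X0: "AE \<omega> in M. X 0 \<omega> = i"
  shows "volterra_queue (transition_prob M X i) \<alpha> lam \<mu> \<xi> i"
proof
  let ?p = "transition_prob M X i"
  note P = transition_prob_eq_prob[OF X0]
  have pos: "0 < \<P>(\<omega> in M. X 0 \<omega> = i)"
  proof -
    have "{\<omega> \<in> space M. X 0 \<omega> = i} \<in> events"
      using measurable_sets[OF process[of 0], of "{i}"] by (simp add: vimage_def Int_def conj_commute)
    then have "\<P>(\<omega> in M. X 0 \<omega> = i) = 1" using X0 by (simp add: prob_Collect_eq_1)
    then show ?thesis by simp
  qed
  show meas: "set_borel_measurable lebesgue {0..} (?p n)" for n
    by (intro continuous_on_imp_set_borel_measurable_lebesgue locally_absolutely_continuous_imp_continuous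
        abs_continuous pos)
  show "0 \<le> ?p n t" if "0 \<le> t" for n t using that by (simp add: P)
  show "(\<lambda>n. ?p n t) sums 1" if "0 \<le> t" for t
    using prob_eq_sums_1[OF process[OF that]] that by (simp add: P)
  show "?p n t = (if i = n then 1 else 0) + frac_int \<alpha>
      (\<lambda>u. - (lam + \<mu> + \<xi>) * ?p n u + lam * ?p (n - 1) u + \<mu> * ?p (n + 1) u) t" if n: "1 \<le> n" and t: "0 \<le> t" for n t
  proof -
    have "set_borel_measurable lebesgue {0..}
        (\<lambda>u. 1 * (- (lam + \<mu> + \<xi>) * ?p n u + lam * ?p (n - 1) u) + \<mu> * ?p (n + 1) u)"
      by (intro set_borel_measurable_lincomb meas)
    then show ?thesis
      using caputo_imp_volterra[OF order abs_continuous[OF pos] equation_pos[OF pos n] _ t]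
      by (simp add: initial[OF pos])
  qed
qed (use order rates in auto)

end

theorem theorem2p5:
  fixes M :: "'w measure" and X :: "real \<Rightarrow> 'w \<Rightarrow> nat" and \<alpha> lam \<mu> \<xi> t :: real and i :: nat
  assumes "0 < lam" and "0 < \<mu>" and "0 < \<xi>" and "0 < \<alpha>" and "\<alpha> \<le> 1"
    and "fractional_queue_catastrophes M X \<alpha> lam \<mu> \<xi>"
    and "AE \<omega> in M. X 0 \<omega> = i"
    and "0 < t"
  shows "integrable M (\<lambda>\<omega>. real (X t \<omega>)) \<and>
    (LINT \<omega>|M. real (X t \<omega>)) =
      real i * mittag_leffler 1 \<alpha> 1 (- \<xi> * t powr \<alpha>)
      + \<mu> * time_convolution (transition_prob M X i 0)
               (\<lambda>s. s powr (\<alpha> - 1) * mittag_leffler 1 \<alpha> \<alpha> (- \<xi> * s powr \<alpha>)) t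
      + (lam - \<mu>) / \<xi> * (1 - mittag_leffler 1 \<alpha> 1 (- \<xi> * t powr \<alpha>))"
proof -
  interpret Q: fractional_queue_catastrophes M X \<alpha> lam \<mu> \<xi> by fact
  interpret V: volterra_queue "transition_prob M X i" \<alpha> lam \<mu> \<xi> i
    by (rule Q.volterra_queue_transition_prob) fact
  have t: "0 \<le> t" using \<open>0 < t\<close> by simp
  have P: "transition_prob M X i n t = measure M {\<omega> \<in> space M. X t \<omega> = n}" for n
    by (rule Q.transition_prob_eq_prob[OF assms(7) t])
  have S: "(\<lambda>n. real n * measure M {\<omega> \<in> space M. X t \<omega> = n}) sums V.mean t"
    using V.mean_sums[OF t] by (simp only: P)
  note Y = Q.process[OF t] sums_summable[OF S]
  have "(LINT \<omega>|M. real (X t \<omega>)) = V.mean t"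
    using Q.expectation_nat_valued[OF Y] sums_unique[OF S] by simp
  then show ?thesis
    using Q.integrable_nat_valued[OF Y] V.mean_eq[OF \<open>0 < \<xi>\<close> \<open>0 < t\<close>] by simp
qed

end
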